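(* Fix an integer $d \geq 3$. Then, as $q \to \infty$ through odd prime powers, $$ \mathrm{Nikodym}(d,q) \leq q^d - \left(\frac{d-2}{\log 2}+1+o(1)\right) q^{d-1} \log q. $$ That is, for every $\delta>0$ there exists $q_0 = q_0(d,\delta)$ such that for every odd prime power $q \geq q_0$ one has $\mathrm{Nikodym}(d,q) \leq q^d - \left(\frac{d-2}{\log 2}+1-\delta\right) q^{d-1}\log q$.
   Context: $\mathbf{F}_q$ is the finite field with $q$ elements, and $\log$ is the natural logarithm. A direction in $\mathbf{F}_q^d$ is a set of the form $\omega = [v_1,\dots,v_d] = \{(tv_1,\dots,tv_d): t \in \mathbf{F}_q\setminus\{0\}\}$ with $v_1,\dots,v_d \in \mathbf{F}_q$ not all zero; $\mathbf{FP}_q^{d-1}$ is the set of all directions. For $x \in \mathbf{F}_q^d$ and $\omega \in \mathbf{FP}_q^{d-1}$, the punctured line is $\ell^*_{x,\omega} = x + \omega$ (the line through $x$ in the direction $\omega$ with $x$ removed). A Nikodym set is a subset $N \subset \mathbf{F}_q^d$ such that for every $x \in \mathbf{F}_q^d$ there exists $\omega \in \mathbf{FP}_q^{d-1}$ with $\ell^*_{x,\omega} \subset N$. $\mathrm{Nikodym}(d,q)$ denotes the minimum cardinality of a Nikodym set in $\mathbf{F}_q^d$. *)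

theory Defs
  imports
    Complex_Main
    "HOL-Algebra.Ring"
    "HOL-Algebra.Coset"
    "HOL-Number_Theory.Prime_Powers"
begin

definition vec_space :: "('a, 'b) ring_scheme \<Rightarrow> nat \<Rightarrow> (nat \<Rightarrow> 'a) set" where
  "vec_space R d = {..<d} \<rightarrow>\<^sub>E carrier R"

definition vec_add ::
    "('a, 'b) ring_scheme \<Rightarrow> nat \<Rightarrow> (nat \<Rightarrow> 'a) \<Rightarrow> (nat \<Rightarrow> 'a) \<Rightarrow> nat \<Rightarrow> 'a" where
  "vec_add R d x y = (\<lambda>i\<in>{..<d}. x i \<oplus>\<^bsub>R\<^esub> y i)"

definition vec_smult ::
    "('a, 'b) ring_scheme \<Rightarrow> nat \<Rightarrow> 'a \<Rightarrow> (nat \<Rightarrow> 'a) \<Rightarrow> nat \<Rightarrow> 'a" where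
  "vec_smult R d t v = (\<lambda>i\<in>{..<d}. t \<otimes>\<^bsub>R\<^esub> v i)"

definition direction :: "('a, 'b) ring_scheme \<Rightarrow> nat \<Rightarrow> (nat \<Rightarrow> 'a) \<Rightarrow> (nat \<Rightarrow> 'a) set" where
  "direction R d v = {vec_smult R d t v | t. t \<in> carrier R - {\<zero>\<^bsub>R\<^esub>}}"

definition directions :: "('a, 'b) ring_scheme \<Rightarrow> nat \<Rightarrow> (nat \<Rightarrow> 'a) set set" where
  "directions R d = {direction R d v | v. v \<in> vec_space R d \<and> (\<exists>i<d. v i \<noteq> \<zero>\<^bsub>R\<^esub>)}"

definition punctured_line ::
    "('a, 'b) ring_scheme \<Rightarrow> nat \<Rightarrow> (nat \<Rightarrow> 'a) \<Rightarrow> (nat \<Rightarrow> 'a) set \<Rightarrow> (nat \<Rightarrow> 'a) set" where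
  "punctured_line R d x \<omega> = vec_add R d x ` \<omega>"

definition nikodym_set :: "('a, 'b) ring_scheme \<Rightarrow> nat \<Rightarrow> (nat \<Rightarrow> 'a) set \<Rightarrow> bool" where
  "nikodym_set R d N \<longleftrightarrow>
     N \<subseteq> vec_space R d \<and>
     (\<forall>x\<in>vec_space R d. \<exists>\<omega>\<in>directions R d. punctured_line R d x \<omega> \<subseteq> N)"

(* Meaningful for finite R and d \<ge> 1, when the whole space is a Nikodym set. *)
definition nikodym_number :: "('a, 'b) ring_scheme \<Rightarrow> nat \<Rightarrow> nat" where
  "nikodym_number R d = (LEAST n. \<exists>N. nikodym_set R d N \<and> card N = n)"

(* R is a model of the field with q elements.  Taking the carrier inside nat loses nothing,
   as every finite field is isomorphic to such a structure; one fixed infinite carrier type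
   is needed so that q can be quantified inside a formula. *)
definition is_GF :: "nat \<Rightarrow> nat ring \<Rightarrow> bool" where
  "is_GF q R \<longleftrightarrow> field R \<and> finite (carrier R) \<and> order R = q"

end

theory Submission
  imports Defs "HOL-Library.Disjoint_Sets" "HOL-Algebra.Multiplicative_Group" "HOL-Real_Asymp.Real_Asymp"
begin

text \<open>
  The complement of a set \<open>E\<close> is a Nikodym set as soon as every point \<open>x\<close> has a direction whose
  punctured line misses \<open>E\<close>, so the task is to build a large \<open>E\<close> with this property. Each point has
  about \<open>q ^ (d - 1)\<close> directions, and a construction may spend them: it can afford that all but one of
  them are hit. A random set of density \<open>\<rho> / q\<close> has \<open>\<rho> q ^ (d - 1)\<close> points and leaves a proportion
  \<open>exp (- \<rho>)\<close> of the directions, which gives one unit of \<open>q ^ (d - 1) log q\<close> for each factor \<open>q\<close>. A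
  quadric also has about \<open>q ^ (d - 1)\<close> points, but it meets most lines in \<open>0\<close> or in \<open>2\<close> points, so a
  line misses it with probability about \<open>1 / 2\<close>: a factor \<open>q\<close> of directions buys
  \<open>log q / log 2\<close> quadrics.

  Random quadrics are only pairwise independent on the lines through a point, so the number of surviving
  directions is controlled by Chebyshev's inequality (\<open>chebyshev_count\<close>), with failure probability the
  inverse of the expected number. Points where this fails have to be repaired at a cost of about
  \<open>log q\<close> each, hence must be \<open>o(q ^ (d - 1))\<close> in number, and the quadrics must
  leave \<open>q ^ (1 + \<epsilon>)\<close> directions: they may spend \<open>d - 2 - \<epsilon>\<close> factors \<open>q\<close>
  (\<open>card_bad_samples\<close>, \<open>good_sample_exists\<close>). This is the term
  \<open>(d - 2) / log 2\<close>. The remaining factor \<open>q\<close> is spent on a random set, where punctured lines through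
  the same point are fully independent and the failure probability is exponentially small
  (\<open>exists_sparse_deletion\<close>). This is the term \<open>1\<close>.

  A point \<open>x\<close> on one of the quadrics needs care, since almost every line through \<open>x\<close> meets that
  quadric once more. Therefore the quadrics are thinned: each of their points
  is kept out of \<open>E\<close> with a small constant probability \<open>\<eta>\<close>. A single hit then costs only the factor
  \<open>\<eta>\<close> in the survival probability, and points on two of the quadrics are rare enough to be repaired.

  Repair works by pigeonhole: if \<open>E\<close> has \<open>O(q ^ (d - 1) log q)\<close> points, then each \<open>x\<close> has a direction
  with only \<open>O(log q)\<close> points of \<open>E\<close> on its punctured line, and these can be given back
  (\<open>nikodym_number_le_repair\<close>).
\<close>

section \<open>Random deletion by conditional expectations\<close>

definition affine_in :: "'a \<Rightarrow> (('a \<Rightarrow> real) \<Rightarrow> real) \<Rightarrow> bool" where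
  "affine_in y F \<longleftrightarrow> (\<forall>u t. F (u(y := t)) = (1 - t) * F (u(y := 0)) + t * F (u(y := 1)))"

lemma affine_inD: "affine_in y F \<Longrightarrow> F (u(y := t)) = (1 - t) * F (u(y := 0)) + t * F (u(y := 1))"
  unfolding affine_in_def by blast

text \<open>
  A function that is affine in each coordinate separately attains its maximum over the cube at a vertex:
  moving one coordinate at a time to the better of its two ends never decreases the value. This replaces
  the choice of independent random points, the value at \<open>\<kappa>\<close> being the expectation when coordinate \<open>y\<close>
  is \<open>1\<close> with probability \<open>\<kappa> y\<close>.
\<close>

lemma multiaffine_le_vertex:
  assumes "finite W" and "\<And>y. y \<in> W \<Longrightarrow> affine_in y F"
    and "\<And>y. y \<in> W \<Longrightarrow> 0 \<le> \<kappa> y \<and> \<kappa> y \<le> 1"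
  shows "\<exists>u. (\<forall>y\<in>W. u y \<in> {0, 1}) \<and> (\<forall>y. y \<notin> W \<longrightarrow> u y = \<kappa> y) \<and> F \<kappa> \<le> F u"
  using assms
proof (induction W arbitrary: \<kappa> rule: finite_induct)
  case empty
  then show ?case by auto
next
  case (insert y W)
  have *: "F \<kappa> = (1 - \<kappa> y) * F (\<kappa>(y := 0)) + \<kappa> y * F (\<kappa>(y := 1))"
    using affine_inD[OF insert.prems(1)[OF insertI1], of \<kappa> "\<kappa> y"] by (simp only: fun_upd_triv)
  obtain e where e: "e \<in> {0, 1::real}" "F \<kappa> \<le> F (\<kappa>(y := e))"
  proof (cases "F (\<kappa>(y := 0)) \<le> F (\<kappa>(y := 1))")
    case True
    then have "(1 - \<kappa> y) * F (\<kappa>(y := 0)) \<le> (1 - \<kappa> y) * F (\<kappa>(y := 1))"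
      using insert.prems(2)[of y] by (intro mult_left_mono) auto
    then have "F \<kappa> \<le> F (\<kappa>(y := 1))" using * by (simp add: left_diff_distrib)
    then show ?thesis using that by blast
  next
    case False
    then have "\<kappa> y * F (\<kappa>(y := 1)) \<le> \<kappa> y * F (\<kappa>(y := 0))"
      using insert.prems(2)[of y] by (intro mult_left_mono) auto
    then have "F \<kappa> \<le> F (\<kappa>(y := 0))" using * by (simp add: left_diff_distrib)
    then show ?thesis using that by blast
  qed
  have "0 \<le> (\<kappa>(y := e)) z \<and> (\<kappa>(y := e)) z \<le> 1" if "z \<in> W" for z
    using insert.prems(2)[of z] insert.hyps(2) that by auto
  then obtain u where u: "\<forall>z\<in>W. u z \<in> {0, 1}" "\<forall>z. z \<notin> W \<longrightarrow> u z = (\<kappa>(y := e)) z"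
      "F (\<kappa>(y := e)) \<le> F u"
    using insert.IH[of "\<kappa>(y := e)"] insert.prems(1) by blast
  have "u y = e" using u(2) insert.hyps(2) by simp
  then have "\<forall>z\<in>insert y W. u z \<in> {0, 1}" using u(1) e(1) by blast
  moreover have "\<forall>z. z \<notin> insert y W \<longrightarrow> u z = \<kappa> z" using u(2) by simp
  moreover have "F \<kappa> \<le> F u" using e(2) u(3) by (rule order_trans)
  ultimately show ?case by blast
qed

lemma affine_in_const: "(\<And>u t. F (u(y := t)) = F u) \<Longrightarrow> affine_in y F"
  unfolding affine_in_def by (simp add: algebra_simps)

lemma affine_in_sum:
  assumes "\<And>x. x \<in> X \<Longrightarrow> affine_in y (F x)"
  shows "affine_in y (\<lambda>u. \<Sum>x\<in>X. F x u)"
  unfolding affine_in_def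
proof (intro allI)
  fix u t
  have "(\<Sum>x\<in>X. F x (u(y := t))) = (\<Sum>x\<in>X. (1 - t) * F x (u(y := 0)) + t * F x (u(y := 1)))"
    using assms by (intro sum.cong refl affine_inD)
  then show "(\<Sum>x\<in>X. F x (u(y := t))) = (1 - t) * (\<Sum>x\<in>X. F x (u(y := 0))) + t * (\<Sum>x\<in>X. F x (u(y := 1)))"
    by (simp only: sum.distrib sum_distrib_left)
qed

lemma affine_in_diff:
  assumes "affine_in y F" "affine_in y G"
  shows "affine_in y (\<lambda>u. F u - c * G u)"
  unfolding affine_in_def
proof (intro allI)
  fix u t
  show "F (u(y := t)) - c * G (u(y := t))
      = (1 - t) * (F (u(y := 0)) - c * G (u(y := 0))) + t * (F (u(y := 1)) - c * G (u(y := 1)))"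
    unfolding affine_inD[OF assms(1), of u t] affine_inD[OF assms(2), of u t] by (simp add: algebra_simps)
qed

text \<open>
  If each \<open>z\<close> is kept with probability \<open>u z\<close>, the product is the probability that no block \<open>L j\<close> is fully
  kept. Since the blocks are disjoint, a coordinate occurs in one factor at most, and only linearly there.
\<close>

lemma affine_in_prod_disjoint:
  assumes "finite J" and "\<And>j. j \<in> J \<Longrightarrow> finite (L j)" and dis: "disjoint_family_on L J"
  shows "affine_in y (\<lambda>u. \<Prod>j\<in>J. (1 - (\<Prod>z\<in>L j. u z)))"
proof (cases "\<exists>j\<in>J. y \<in> L j")
  case False
  then have "(\<Prod>z\<in>L j. (u(y := t)) z) = (\<Prod>z\<in>L j. u z)" if "j \<in> J" for j u t
    using that by (intro prod.cong) auto
  then show ?thesis by (intro affine_in_const prod.cong) auto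
next
  case True
  then obtain k where k: "k \<in> J" "y \<in> L k" by blast
  have rest: "(\<Prod>j\<in>J-{k}. (1 - (\<Prod>z\<in>L j. (u(y := t)) z))) = (\<Prod>j\<in>J-{k}. (1 - (\<Prod>z\<in>L j. u z)))" for u t
  proof (intro prod.cong refl arg_cong2[where f = minus])
    fix j z assume "j \<in> J - {k}" "z \<in> L j"
    then have "L j \<inter> L k = {}" using dis k(1) unfolding disjoint_family_on_def by blast
    then have "z \<noteq> y" using k(2) \<open>z \<in> L j\<close> by blast
    then show "(u(y := t)) z = u z" by simp
  qed
  have blk: "(\<Prod>z\<in>L k. (u(y := t)) z) = t * (\<Prod>z\<in>L k - {y}. u z)" for u t
    using k assms(2)[of k] by (subst prod.remove[of _ y]) auto
  have eq: "(\<Prod>j\<in>J. (1 - (\<Prod>z\<in>L j. (u(y := t)) z)))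
      = (1 - t * (\<Prod>z\<in>L k - {y}. u z)) * (\<Prod>j\<in>J-{k}. (1 - (\<Prod>z\<in>L j. u z)))" for u t
    by (subst prod.remove[OF assms(1) k(1)]) (simp only: rest blk)
  show ?thesis
    unfolding affine_in_def eq by (auto simp: algebra_simps)
qed

text \<open>
  Keep each \<open>y\<close> with probability \<open>\<kappa> y\<close> and delete the others. The function \<open>F\<close> below is the
  number of deleted points, minus \<open>card V\<close> for each \<open>x\<close> all of whose blocks are hit. At \<open>\<kappa>\<close> it is
  at least \<open>\<mu>\<close>, because disjoint blocks survive independently. At a vertex where it is positive no \<open>x\<close>
  can be penalized, because one penalty already outweighs all deleted points.
\<close>

lemma exists_sparse_deletion:
  fixes \<kappa> :: "'a \<Rightarrow> real" and L :: "'x \<Rightarrow> 'j \<Rightarrow> 'a set"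
  assumes V: "finite V" and X: "finite X"
    and \<kappa>: "\<And>y. y \<in> V \<Longrightarrow> 0 \<le> \<kappa> y \<and> \<kappa> y \<le> 1"
    and J: "\<And>x. x \<in> X \<Longrightarrow> finite (J x)" "\<And>x. x \<in> X \<Longrightarrow> K \<le> real (card (J x))"
    and L: "\<And>x j. x \<in> X \<Longrightarrow> j \<in> J x \<Longrightarrow> L x j \<subseteq> V" "\<And>x. x \<in> X \<Longrightarrow> disjoint_family_on (L x) (J x)"
    and \<beta>: "0 \<le> \<beta>" "\<And>x j. x \<in> X \<Longrightarrow> j \<in> J x \<Longrightarrow> \<beta> \<le> (\<Prod>y\<in>L x j. \<kappa> y)"
    and \<mu>: "0 < \<mu>" "\<mu> \<le> (\<Sum>y\<in>V. 1 - \<kappa> y) - real (card V) * real (card X) * exp (- \<beta> * K)"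
  obtains E where "E \<subseteq> V" "\<mu> \<le> real (card E)" "\<And>x. x \<in> X \<Longrightarrow> \<exists>j\<in>J x. L x j \<inter> E = {}"
proof -
  define B where "B = (\<lambda>u x. \<Prod>j\<in>J x. (1 - (\<Prod>z\<in>L x j. u z)) :: real)"
  define F where "F = (\<lambda>u. (\<Sum>y\<in>V. 1 - u y) - real (card V) * (\<Sum>x\<in>X. B u x))"
  have aff: "affine_in y F" for y
    unfolding F_def B_def
  proof (intro affine_in_diff affine_in_sum)
    show "affine_in y (\<lambda>u. 1 - u x)" for x
      unfolding affine_in_def by (auto simp: algebra_simps)
    show "affine_in y (\<lambda>u. \<Prod>j\<in>J x. 1 - (\<Prod>z\<in>L x j. u z))" if "x \<in> X" for x
      using that J(1) L finite_subset[OF L(1) V] by (intro affine_in_prod_disjoint) auto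
  qed
  have "B \<kappa> x \<le> exp (- \<beta> * K)" if x: "x \<in> X" for x
  proof -
    have "B \<kappa> x \<le> (\<Prod>j\<in>J x. exp (- \<beta>))"
      unfolding B_def
    proof (intro prod_mono conjI)
      fix j assume j: "j \<in> J x"
      have "(\<Prod>z\<in>L x j. \<kappa> z) \<le> 1"
        using \<kappa> L(1)[OF x j] by (intro prod_le_1) auto
      then show "0 \<le> 1 - (\<Prod>z\<in>L x j. \<kappa> z)" by simp
      show "1 - (\<Prod>z\<in>L x j. \<kappa> z) \<le> exp (- \<beta>)"
        using \<beta>(2)[OF x j] exp_ge_add_one_self[of "-\<beta>"] by linarith
    qed
    also have "\<dots> = exp (- \<beta> * real (card (J x)))" by (simp add: exp_of_nat_mult[symmetric] mult.commute)
    also have "\<dots> \<le> exp (- \<beta> * K)" using J(2)[OF x] \<beta>(1) by (simp add: mult_left_mono)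
    finally show ?thesis .
  qed
  then have "(\<Sum>x\<in>X. B \<kappa> x) \<le> real (card X) * exp (- \<beta> * K)"
    using sum_bounded_above by blast
  then have "real (card V) * (\<Sum>x\<in>X. B \<kappa> x) \<le> real (card V) * (real (card X) * exp (- \<beta> * K))"
    by (intro mult_left_mono) auto
  then have F\<kappa>: "\<mu> \<le> F \<kappa>" using \<mu>(2) unfolding F_def by (simp add: mult.assoc)
  obtain u where u: "\<And>y. y \<in> V \<Longrightarrow> u y \<in> {0, 1}" "F \<kappa> \<le> F u"
    using multiaffine_le_vertex[where \<kappa> = \<kappa>, OF V aff \<kappa>] by auto
  define E where "E = {y\<in>V. u y = 0}"
  have "(\<Sum>y\<in>V. 1 - u y) = (\<Sum>y\<in>V. if y \<in> E then 1 else 0)"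
    using u(1) by (intro sum.cong) (auto simp: E_def)
  also have "\<dots> = real (card E)" using V by (simp add: E_def sum.If_cases Int_def conj_commute)
  finally have cE: "(\<Sum>y\<in>V. 1 - u y) = real (card E)" .
  have prod01: "(\<Prod>z\<in>L x j. u z) = (if L x j \<inter> E = {} then 1 else 0)" if "x \<in> X" "j \<in> J x" for x j
  proof (cases "L x j \<inter> E = {}")
    case True
    then have "u z = 1" if "z \<in> L x j" for z
      using that u(1)[of z] L(1)[OF \<open>x \<in> X\<close> \<open>j \<in> J x\<close>] by (auto simp: E_def)
    then show ?thesis using True by (simp add: prod.neutral)
  next
    case False
    then obtain z where "z \<in> L x j" "u z = 0" by (auto simp: E_def)
    moreover have "finite (L x j)" using L(1)[OF that] V finite_subset by blast
    ultimately show ?thesis using False by (auto intro: prod_zero)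
  qed
  have B0: "B u x \<ge> 0" if "x \<in> X" for x
    unfolding B_def using that by (intro prod_nonneg) (auto simp: prod01)
  have good: "\<exists>j\<in>J x. L x j \<inter> E = {}" if x: "x \<in> X" for x
  proof (rule ccontr)
    assume "\<not> ?thesis"
    then have "B u x = 1" unfolding B_def using prod01[OF x] by (intro prod.neutral) auto
    then have "1 \<le> (\<Sum>x\<in>X. B u x)" using member_le_sum[OF x, of "B u"] B0 X by auto
    then have "real (card V) * 1 \<le> real (card V) * (\<Sum>x\<in>X. B u x)" by (intro mult_left_mono) auto
    moreover have "real (card E) \<le> real (card V)"
      using card_mono[OF V, of E] by (auto simp: E_def)
    ultimately have "F u \<le> 0" unfolding F_def cE by simp
    then show False using F\<kappa> u(2) \<mu>(1) by linarith
  qed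
  have "0 \<le> real (card V) * (\<Sum>x\<in>X. B u x)" using B0 by (intro mult_nonneg_nonneg sum_nonneg) auto
  then have "\<mu> \<le> real (card E)" using F\<kappa> u(2) unfolding F_def cE by linarith
  then show ?thesis using that[of E] good by (auto simp: E_def)
qed

section \<open>Counting in finite sample spaces\<close>

text \<open>
  Chebyshev's inequality for the number of pairwise independent events of equal probability \<open>p\<close> that
  occur, with counting in place of measure: the variance is \<open>p (1 - p) card I \<le> p card I\<close>.
\<close>

lemma chebyshev_count:
  fixes p r :: real
  assumes "finite \<Omega>" "finite I" "r > 0"
    and one: "\<And>i. i \<in> I \<Longrightarrow> real (card {\<omega>\<in>\<Omega>. A i \<omega>}) = p * real (card \<Omega>)"
    and two: "\<And>i j. i \<in> I \<Longrightarrow> j \<in> I \<Longrightarrow> i \<noteq> j \<Longrightarrow>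
                real (card {\<omega>\<in>\<Omega>. A i \<omega> \<and> A j \<omega>}) = p\<^sup>2 * real (card \<Omega>)"
  shows "real (card {\<omega>\<in>\<Omega>. \<bar>real (card {i\<in>I. A i \<omega>}) - p * card I\<bar> \<ge> r}) * r\<^sup>2 \<le> p * card I * card \<Omega>"
proof -
  define X where "X = (\<lambda>\<omega>. \<Sum>i\<in>I. of_bool (A i \<omega>) :: real)"
  have X: "X \<omega> = real (card {i\<in>I. A i \<omega>})" for \<omega>
    unfolding X_def using assms(2) by (simp add: sum.If_cases of_bool_def Int_def)
  have E: "(\<Sum>\<omega>\<in>\<Omega>. of_bool (P \<omega>) :: real) = real (card {\<omega>\<in>\<Omega>. P \<omega>})" for P
    using assms(1) by (simp add: sum.If_cases of_bool_def Int_def)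
  define n where "n = real (card I)"
  define M where "M = real (card \<Omega>)"
  have s1: "(\<Sum>\<omega>\<in>\<Omega>. X \<omega>) = n * p * M"
    unfolding X_def by (subst sum.swap) (simp add: E one n_def M_def)
  have s2: "(\<Sum>\<omega>\<in>\<Omega>. (X \<omega>)\<^sup>2) = n * (p * M + (n - 1) * (p\<^sup>2 * M))"
  proof -
    have "(\<Sum>\<omega>\<in>\<Omega>. (X \<omega>)\<^sup>2) = (\<Sum>\<omega>\<in>\<Omega>. \<Sum>i\<in>I. \<Sum>j\<in>I. of_bool (A i \<omega> \<and> A j \<omega>))"
      unfolding X_def power2_eq_square sum_product by (simp add: of_bool_conj)
    also have "\<dots> = (\<Sum>i\<in>I. \<Sum>\<omega>\<in>\<Omega>. \<Sum>j\<in>I. of_bool (A i \<omega> \<and> A j \<omega>))" by (rule sum.swap)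
    also have "\<dots> = (\<Sum>i\<in>I. \<Sum>j\<in>I. \<Sum>\<omega>\<in>\<Omega>. of_bool (A i \<omega> \<and> A j \<omega>))"
      by (intro sum.cong refl sum.swap)
    also have "\<dots> = (\<Sum>i\<in>I. p * M + (n - 1) * (p\<^sup>2 * M))"
    proof (rule sum.cong[OF refl])
      fix i assume i: "i \<in> I"
      have "(\<Sum>j\<in>I. \<Sum>\<omega>\<in>\<Omega>. of_bool (A i \<omega> \<and> A j \<omega>) :: real)
          = (\<Sum>\<omega>\<in>\<Omega>. of_bool (A i \<omega> \<and> A i \<omega>)) + (\<Sum>j\<in>I-{i}. \<Sum>\<omega>\<in>\<Omega>. of_bool (A i \<omega> \<and> A j \<omega>))"
        by (rule sum.remove[OF assms(2) i])
      also have "(\<Sum>j\<in>I-{i}. \<Sum>\<omega>\<in>\<Omega>. of_bool (A i \<omega> \<and> A j \<omega>) :: real) = (\<Sum>j\<in>I-{i}. p\<^sup>2 * M)"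
        
        unfolding E using two[OF i] by (intro sum.cong refl) (auto simp: M_def)
      also have "\<dots> = (n - 1) * (p\<^sup>2 * M)"
        using i assms(2) card_gt_0_iff[of I] by (auto simp: n_def card_Diff_singleton of_nat_diff Suc_leI)
      finally show "(\<Sum>j\<in>I. \<Sum>\<omega>\<in>\<Omega>. of_bool (A i \<omega> \<and> A j \<omega>) :: real) = p * M + (n - 1) * (p\<^sup>2 * M)"
        using i by (simp add: E one M_def)
    qed
    finally show ?thesis by (simp add: n_def)
  qed
  have "real (card {\<omega>\<in>\<Omega>. \<bar>X \<omega> - p * n\<bar> \<ge> r}) * r\<^sup>2 = (\<Sum>\<omega>\<in>{\<omega>\<in>\<Omega>. \<bar>X \<omega> - p * n\<bar> \<ge> r}. r\<^sup>2)" by simp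
  also have "\<dots> \<le> (\<Sum>\<omega>\<in>{\<omega>\<in>\<Omega>. \<bar>X \<omega> - p * n\<bar> \<ge> r}. (X \<omega> - p * n)\<^sup>2)"
    using assms(3) by (intro sum_mono) (auto simp: abs_le_square_iff[symmetric])
  also have "\<dots> \<le> (\<Sum>\<omega>\<in>\<Omega>. (X \<omega> - p * n)\<^sup>2)" using assms(1) by (intro sum_mono2) auto
  also have "\<dots> = (\<Sum>\<omega>\<in>\<Omega>. (X \<omega>)\<^sup>2) - 2 * p * n * (\<Sum>\<omega>\<in>\<Omega>. X \<omega>) + M * (p * n)\<^sup>2"
  proof -
    have "(X \<omega> - p * n)\<^sup>2 = ((X \<omega>)\<^sup>2 - 2 * p * n * X \<omega>) + (p * n)\<^sup>2" for \<omega>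
      by (simp add: power2_diff)
    then show ?thesis by (simp only: sum.distrib sum_subtractf sum_distrib_left sum_constant M_def)
  qed
  also have "\<dots> = p * n * M - n * p\<^sup>2 * M" unfolding s1 s2 by (simp add: algebra_simps power2_eq_square)
  also have "\<dots> \<le> p * n * M" by (simp add: n_def M_def)
  finally show ?thesis unfolding X n_def M_def by simp
qed

lemma card_iid:
  "card {\<omega> \<in> {..<m::nat} \<rightarrow>\<^sub>E \<Theta>. \<forall>i<m. P (\<omega> i)} = card {\<theta>\<in>\<Theta>. P \<theta>} ^ m"
proof -
  have "{\<omega> \<in> {..<m} \<rightarrow>\<^sub>E \<Theta>. \<forall>i<m. P (\<omega> i)} = {..<m} \<rightarrow>\<^sub>E {\<theta>\<in>\<Theta>. P \<theta>}"
    by (rule Set.set_eqI) (simp only: mem_Collect_eq PiE_iff Ball_def lessThan_iff, blast)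
  then show ?thesis by (simp only: card_PiE[OF finite_lessThan] prod_constant card_lessThan)
qed

text \<open>
  If any fibre of \<open>f\<close> over \<open>T\<close> can be injected into any other one, then all fibres have the same size, so
  that \<open>f\<close> is uniformly distributed on \<open>T\<close>. For additive maps the injections are translations.
\<close>

lemma card_preimage_uniform_fibres:
  assumes "finite \<Theta>" "finite T" "f \<in> \<Theta> \<rightarrow> T" "S \<subseteq> T"
    and "\<And>s t. s \<in> T \<Longrightarrow> t \<in> T \<Longrightarrow> \<exists>g. inj_on g \<Theta> \<and> g \<in> \<Theta> \<rightarrow> \<Theta> \<and> (\<forall>\<theta>\<in>\<Theta>. f \<theta> = s \<longrightarrow> f (g \<theta>) = t)"
  shows "card {\<theta>\<in>\<Theta>. f \<theta> \<in> S} * card T = card S * card \<Theta>"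
proof -
  define N where "N = (\<lambda>t. card {\<theta>\<in>\<Theta>. f \<theta> = t})"
  have le: "N s \<le> N t" if "s \<in> T" "t \<in> T" for s t
  proof -
    obtain g where g: "inj_on g \<Theta>" "g \<in> \<Theta> \<rightarrow> \<Theta>" "\<forall>\<theta>\<in>\<Theta>. f \<theta> = s \<longrightarrow> f (g \<theta>) = t"
      using assms(5)[OF \<open>s \<in> T\<close> \<open>t \<in> T\<close>] by blast
    show ?thesis unfolding N_def
      using g assms(1) by (intro card_inj_on_le[of g]) (auto intro: inj_on_subset)
  qed
  have sum: "card {\<theta>\<in>\<Theta>. f \<theta> \<in> S'} = (\<Sum>t\<in>S'. N t)" if "S' \<subseteq> T" for S'
  proof -
    have "{\<theta>\<in>\<Theta>. f \<theta> \<in> S'} = (\<Union>t\<in>S'. {\<theta>\<in>\<Theta>. f \<theta> = t})" by auto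
    then show ?thesis unfolding N_def
      using assms(1) finite_subset[OF that assms(2)] by (subst card_UN_disjoint[symmetric]) auto
  qed
  show ?thesis
  proof (cases "T = {}")
    case False
    then obtain t0 where t0: "t0 \<in> T" by blast
    have N: "N t = N t0" if "t \<in> T" for t using le t0 that by (simp add: le_antisym)
    have "card {\<theta>\<in>\<Theta>. f \<theta> \<in> S} = card S * N t0" using sum[OF assms(4)] N assms(4) by (simp add: subset_iff)
    moreover have "{\<theta>\<in>\<Theta>. f \<theta> \<in> T} = \<Theta>" using assms(3) by auto
    then have "card \<Theta> = card T * N t0" using sum[of T] N by simp
    ultimately show ?thesis by simp
  qed (use assms in auto)
qed

lemma density_of_count:
  fixes n k s p :: nat and r :: real
  assumes "n * k = s * p" "real s = r * real k" "0 < k"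
  shows "real n = r * real p"
proof -
  have "real n * real k = real s * real p" using assms(1) by (metis of_nat_mult)
  then show ?thesis unfolding assms(2) using assms(3) by simp
qed

lemma card_iid_real:
  assumes "real (card {\<theta>\<in>\<Theta>. P \<theta>}) = r * real (card \<Theta>)"
  shows "real (card {\<omega> \<in> {..<m::nat} \<rightarrow>\<^sub>E \<Theta>. \<forall>i<m. P (\<omega> i)}) = r ^ m * real (card ({..<m} \<rightarrow>\<^sub>E \<Theta>))"
  unfolding card_iid using assms by (simp add: card_PiE power_mult_distrib)

lemma card_two_coordinates:
  fixes i j m :: nat
  assumes "i < m" "j < m" "i \<noteq> j"
  shows "card {\<omega> \<in> {..<m} \<rightarrow>\<^sub>E \<Theta>. P (\<omega> i) \<and> P (\<omega> j)} * card \<Theta> ^ 2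
    = card {\<theta>\<in>\<Theta>. P \<theta>} ^ 2 * card ({..<m} \<rightarrow>\<^sub>E \<Theta>)"
proof -
  define B where "B = (\<lambda>k. if k = i \<or> k = j then {\<theta>\<in>\<Theta>. P \<theta>} else \<Theta>)"
  have eq: "{\<omega> \<in> {..<m} \<rightarrow>\<^sub>E \<Theta>. P (\<omega> i) \<and> P (\<omega> j)} = Pi\<^sub>E {..<m} B" (is "?L = ?R")
  proof (intro equalityI subsetI)
    fix \<omega> assume "\<omega> \<in> ?L"
    then show "\<omega> \<in> ?R"
      unfolding B_def by (intro PiE_I) (auto dest: PiE_mem PiE_arb)
  next
    fix \<omega> assume \<omega>: "\<omega> \<in> ?R"
    have "\<omega> k \<in> \<Theta>" if "k \<in> {..<m}" for k
      using PiE_mem[OF \<omega> that] by (auto simp: B_def split: if_splits)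
    moreover have "\<omega> k = undefined" if "k \<notin> {..<m}" for k using PiE_arb[OF \<omega> that] .
    ultimately have "\<omega> \<in> {..<m} \<rightarrow>\<^sub>E \<Theta>" by (rule PiE_I)
    moreover have "P (\<omega> i)" "P (\<omega> j)"
      using PiE_mem[OF \<omega>, of i] PiE_mem[OF \<omega>, of j] assms by (auto simp: B_def)
    ultimately show "\<omega> \<in> ?L" by blast
  qed
  have split: "(\<Prod>k<m. g k) = g i * g j * (\<Prod>k\<in>{..<m} - {i} - {j}. g k)" for g :: "nat \<Rightarrow> nat"
    using assms by (simp add: prod.remove[of "{..<m}" i] prod.remove[of "{..<m} - {i}" j] mult.assoc)
  have "(\<Prod>k\<in>{..<m} - {i} - {j}. card (B k)) = (\<Prod>k\<in>{..<m} - {i} - {j}. card \<Theta>)"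
    by (intro prod.cong) (auto simp: B_def)
  then have "card (Pi\<^sub>E {..<m} B) = card {\<theta>\<in>\<Theta>. P \<theta>} ^ 2 * (\<Prod>k\<in>{..<m} - {i} - {j}. card \<Theta>)"
    unfolding card_PiE[OF finite_lessThan] split[of "\<lambda>k. card (B k)"] by (simp add: B_def power2_eq_square)
  moreover have "card ({..<m} \<rightarrow>\<^sub>E \<Theta>) = card \<Theta> ^ 2 * (\<Prod>k\<in>{..<m} - {i} - {j}. card \<Theta>)"
    unfolding card_PiE[OF finite_lessThan] split[of "\<lambda>k. card \<Theta>"] by (simp add: power2_eq_square)
  ultimately show ?thesis unfolding eq by simp
qed

section \<open>Linear forms on the vector space over a finite field\<close>

locale finite_affine_space = field R for R :: "('a::linorder, 'b) ring_scheme" (structure) +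
  fixes d :: nat
  assumes finite_carrier [simp, intro]: "finite (carrier R)"
    and two_le_d: "2 \<le> d"
begin

abbreviation "F \<equiv> carrier R"
abbreviation "q \<equiv> card (carrier R)"
abbreviation "V \<equiv> vec_space R d"
abbreviation "addv \<equiv> vec_add R d"

definition dot :: "(nat \<Rightarrow> 'a) \<Rightarrow> (nat \<Rightarrow> 'a) \<Rightarrow> 'a" where
  "dot a v = (\<Oplus>i\<in>{..<d}. a i \<otimes> v i)"

definition axis :: "nat \<Rightarrow> 'a \<Rightarrow> nat \<Rightarrow> 'a" where
  "axis k s = (\<lambda>i\<in>{..<d}. if i = k then s else \<zero>)"

definition line_pt :: "(nat \<Rightarrow> 'a) \<Rightarrow> (nat \<Rightarrow> 'a) \<Rightarrow> 'a \<Rightarrow> nat \<Rightarrow> 'a" where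
  "line_pt x v t = addv x (vec_smult R d t v)"

lemma finite_V [simp]: "finite V"
  unfolding vec_space_def by (intro finite_PiE) auto

lemma card_V: "card V = q ^ d"
  unfolding vec_space_def by (simp add: card_PiE)

lemma V_coord [simp, intro]: "x \<in> V \<Longrightarrow> i < d \<Longrightarrow> x i \<in> F"
  unfolding vec_space_def by auto

lemma V_coord0 [simp, intro]: "x \<in> V \<Longrightarrow> x 0 \<in> F"
  using two_le_d by (intro V_coord) auto

lemma V_eqI: "x \<in> V \<Longrightarrow> y \<in> V \<Longrightarrow> (\<And>i. i < d \<Longrightarrow> x i = y i) \<Longrightarrow> x = y"
  unfolding vec_space_def by (rule PiE_ext) auto

lemma addv_closed [simp, intro]: "x \<in> V \<Longrightarrow> y \<in> V \<Longrightarrow> addv x y \<in> V"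
  unfolding vec_space_def vec_add_def by auto

lemma smult_closed [simp, intro]: "t \<in> F \<Longrightarrow> y \<in> V \<Longrightarrow> vec_smult R d t y \<in> V"
  unfolding vec_space_def vec_smult_def by auto

lemma axis_closed [simp, intro]: "s \<in> F \<Longrightarrow> axis k s \<in> V"
  unfolding vec_space_def axis_def by auto

lemma line_pt_closed [simp, intro]: "x \<in> V \<Longrightarrow> v \<in> V \<Longrightarrow> t \<in> F \<Longrightarrow> line_pt x v t \<in> V"
  unfolding line_pt_def by auto

lemma addv_right_cancel: "x \<in> V \<Longrightarrow> y \<in> V \<Longrightarrow> u \<in> V \<Longrightarrow> addv x u = addv y u \<Longrightarrow> x = y"
  by (rule V_eqI) (auto simp: vec_add_def restrict_def fun_eq_iff split: if_splits)

lemma dot_closed [simp, intro]: "a \<in> V \<Longrightarrow> v \<in> V \<Longrightarrow> dot a v \<in> F"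
  unfolding dot_def by (intro finsum_closed) auto

lemma dot_add_left:
  assumes "a \<in> V" "a' \<in> V" "v \<in> V"
  shows "dot (addv a a') v = dot a v \<oplus> dot a' v"
proof -
  have "dot (addv a a') v = (\<Oplus>i\<in>{..<d}. a i \<otimes> v i \<oplus> a' i \<otimes> v i)"
    unfolding dot_def using assms by (intro finsum_cong') (auto simp: vec_add_def l_distr)
  also have "\<dots> = dot a v \<oplus> dot a' v"
    unfolding dot_def using assms by (intro finsum_addf) auto
  finally show ?thesis .
qed

lemma dot_add_right:
  assumes "a \<in> V" "v \<in> V" "v' \<in> V"
  shows "dot a (addv v v') = dot a v \<oplus> dot a v'"
proof -
  have "dot a (addv v v') = (\<Oplus>i\<in>{..<d}. a i \<otimes> v i \<oplus> a i \<otimes> v' i)"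
    unfolding dot_def using assms by (intro finsum_cong') (auto simp: vec_add_def r_distr)
  also have "\<dots> = dot a v \<oplus> dot a v'"
    unfolding dot_def using assms by (intro finsum_addf) auto
  finally show ?thesis .
qed

lemma dot_smult_right:
  assumes "a \<in> V" "v \<in> V" "t \<in> F"
  shows "dot a (vec_smult R d t v) = t \<otimes> dot a v"
proof -
  have "dot a (vec_smult R d t v) = (\<Oplus>i\<in>{..<d}. t \<otimes> (a i \<otimes> v i))"
    unfolding dot_def using assms by (intro finsum_cong') (auto simp: vec_smult_def m_lcomm)
  also have "\<dots> = t \<otimes> dot a v"
    unfolding dot_def using assms by (intro finsum_rdistr[symmetric]) auto
  finally show ?thesis .
qed

lemma dot_axis: "k < d \<Longrightarrow> s \<in> F \<Longrightarrow> v \<in> V \<Longrightarrow> dot (axis k s) v = s \<otimes> v k"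
proof -
  assume k: "k < d" and s: "s \<in> F" and v: "v \<in> V"
  have "dot (axis k s) v = (\<Oplus>i\<in>{..<d}. if k = i then s \<otimes> v i else \<zero>)"
    unfolding dot_def axis_def using s v by (intro finsum_cong') (auto simp: k)
  also have "\<dots> = s \<otimes> v k"
    using k s v by (intro finsum_singleton) auto
  finally show ?thesis .
qed

text \<open>
  One vector for each direction that is not parallel to the hyperplane \<open>x 0 = 0\<close>. Ignoring the other
  directions does not affect the asymptotics.
\<close>

definition normalized_dirs :: "(nat \<Rightarrow> 'a) set" where
  "normalized_dirs = {v \<in> V. v 0 = \<one>}"

lemma normalized_dirs_V: "v \<in> normalized_dirs \<Longrightarrow> v \<in> V" 
  and normalized_dirs_0: "v \<in> normalized_dirs \<Longrightarrow> v 0 = \<one>"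
  by (auto simp: normalized_dirs_def)

lemma card_normalized_dirs: "card normalized_dirs = q ^ (d - 1)"
proof -
  have d0: "0 < d" using two_le_d by linarith
  have eq: "normalized_dirs = (\<Pi>\<^sub>E i\<in>{..<d}. if i = 0 then {\<one>} else F)" (is "_ = ?P")
  proof (intro equalityI subsetI)
    fix v assume v: "v \<in> normalized_dirs"
    show "v \<in> ?P"
    proof (rule PiE_I)
      show "v i \<in> (if i = 0 then {\<one>} else F)" if "i \<in> {..<d}" for i
        using that normalized_dirs_V[OF v] normalized_dirs_0[OF v] by simp
      show "v i = undefined" if "i \<notin> {..<d}" for i
        using PiE_arb[OF _ that] normalized_dirs_V[OF v] unfolding vec_space_def by blast
    qed
  next
    fix v assume v: "v \<in> ?P"
    have v0: "v 0 = \<one>" using PiE_mem[OF v, of 0] d0 by simp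
    have "v i \<in> F" if "i < d" for i using PiE_mem[OF v, of i] that v0 by (cases "i = 0") auto
    moreover have "v i = undefined" if "i \<notin> {..<d}" for i using PiE_arb[OF v that] .
    ultimately have "v \<in> V" unfolding vec_space_def by (intro PiE_I) auto
    then show "v \<in> normalized_dirs" using v0 by (simp add: normalized_dirs_def)
  qed
  have "card normalized_dirs = (\<Prod>i\<in>{..<d}. card (if i = 0 then {\<one>} else F))"
    unfolding eq by (rule card_PiE) simp
  also have "\<dots> = (\<Prod>i\<in>{..<d} - {0}. card (if i = 0 then {\<one>} else F))"
    using d0 by (simp add: prod.remove[of "{..<d}" 0])
  also have "\<dots> = (\<Prod>i\<in>{..<d} - {0}. q)" by (intro prod.cong) auto
  also have "\<dots> = q ^ (d - 1)" using d0 by (simp add: card_Diff_singleton)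
  finally show ?thesis .
qed

lemma differing_coord:
  assumes "x \<in> V" "y \<in> V" "x \<noteq> y" obtains j where "j < d" "x j \<ominus> y j \<noteq> \<zero>"
proof -
  obtain j where j: "j < d" "x j \<noteq> y j" using V_eqI[OF assms(1,2)] assms(3) by blast
  then have "x j \<ominus> y j \<noteq> \<zero>" using assms(1,2) by simp
  then show ?thesis using that j(1) by blast
qed

text \<open>
  The normalization \<open>v 0 = 1\<close> makes two distinct vectors linearly independent; the form \<open>u\<close>
  can be supported on coordinate \<open>0\<close> and one coordinate in which \<open>v\<close> and \<open>v'\<close> differ.
\<close>

lemma dot_pair_surj:
  assumes "v \<in> normalized_dirs" "v' \<in> normalized_dirs" "v \<noteq> v'" "s \<in> F" "s' \<in> F"
  obtains u where "u \<in> V" "dot u v = s" "dot u v' = s'"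
proof -
  note v = normalized_dirs_V[OF assms(1)] normalized_dirs_0[OF assms(1)]
    normalized_dirs_V[OF assms(2)] normalized_dirs_0[OF assms(2)]
  obtain j where j: "j < d" "v j \<ominus> v' j \<noteq> \<zero>"
    using differing_coord[OF v(1,3) assms(3)] .
  define e where "e = v j \<ominus> v' j"
  have e: "e \<in> F" "e \<noteq> \<zero>" "inv e \<in> F" "inv e \<otimes> e = \<one>"
    using j v by (auto simp: e_def field_Units)
  define \<beta> where "\<beta> = (s \<ominus> s') \<otimes> inv e"
  have \<beta>: "\<beta> \<in> F" "\<beta> \<otimes> e = s \<ominus> s'" using e assms by (auto simp: \<beta>_def m_assoc)
  define \<alpha> where "\<alpha> = s \<ominus> \<beta> \<otimes> v j"
  have \<alpha>: "\<alpha> \<in> F" using \<beta> assms j v by (auto simp: \<alpha>_def)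
  have vj: "v j \<in> F" "v' j \<in> F" using v j by auto
  define u where "u = addv (axis 0 \<alpha>) (axis j \<beta>)"
  have "dot u w = \<alpha> \<otimes> w 0 \<oplus> \<beta> \<otimes> w j" if "w \<in> V" for w
    unfolding u_def using that \<alpha> \<beta> j two_le_d by (simp add: dot_add_left dot_axis)
  then have "dot u v = \<alpha> \<oplus> \<beta> \<otimes> v j" "dot u v' = \<alpha> \<oplus> \<beta> \<otimes> v' j"
    using v \<alpha> by auto
  moreover have "\<alpha> \<oplus> \<beta> \<otimes> v j = s"
    using assms \<beta>(1) vj unfolding \<alpha>_def by algebra
  moreover have "\<alpha> \<oplus> \<beta> \<otimes> v' j = s'"
  proof -
    have "\<alpha> \<oplus> \<beta> \<otimes> v' j = s \<ominus> \<beta> \<otimes> e"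
      unfolding \<alpha>_def e_def using assms \<beta>(1) vj by algebra
    also have "\<dots> = s'" unfolding \<beta>(2) using assms by algebra
    finally show ?thesis .
  qed
  moreover have "u \<in> V" using \<alpha> \<beta> by (auto simp: u_def)
  ultimately show ?thesis using that by metis
qed

section \<open>A pairwise independent family of quadrics\<close>

definition params :: "((nat \<Rightarrow> 'a) \<times> (nat \<Rightarrow> 'a) \<times> 'a) set" where
  "params = V \<times> V \<times> F"

text \<open>
  The polynomial \<open>c + b \<cdot> y + y\<^sub>0 (a \<cdot> y)\<close>. A general quadratic form has more coefficients than needed: it suffices
  that the leading coefficient along \<open>v\<close>, which is the quadratic part at \<open>v\<close>, be pairwise independent for normalized
  \<open>v\<close>, and there \<open>y\<^sub>0 (a \<cdot> y)\<close> takes the value \<open>a \<cdot> v\<close>.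
\<close>

fun quad :: "(nat \<Rightarrow> 'a) \<times> (nat \<Rightarrow> 'a) \<times> 'a \<Rightarrow> (nat \<Rightarrow> 'a) \<Rightarrow> 'a" where
  "quad (a, b, c) y = c \<oplus> dot b y \<oplus> y 0 \<otimes> dot a y"

text \<open>
  With \<open>lead\<close>, the coefficients of \<open>t\<close> and \<open>t\<^sup>2\<close> in the value of the quadric at \<open>x + t v\<close>, for normalized \<open>v\<close>.
\<close>

fun slope :: "(nat \<Rightarrow> 'a) \<times> (nat \<Rightarrow> 'a) \<times> 'a \<Rightarrow> (nat \<Rightarrow> 'a) \<Rightarrow> (nat \<Rightarrow> 'a) \<Rightarrow> 'a" where
  "slope (a, b, c) x v = dot b v \<oplus> x 0 \<otimes> dot a v \<oplus> dot a x"

fun lead :: "(nat \<Rightarrow> 'a) \<times> (nat \<Rightarrow> 'a) \<times> 'a \<Rightarrow> (nat \<Rightarrow> 'a) \<Rightarrow> 'a" where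
  "lead (a, b, c) v = dot a v"

fun add_params where
  "add_params (a, b, c) (a', b', c') = (addv a a', addv b b', c \<oplus> c')"

lemma finite_params [simp]: "finite params" by (simp add: params_def)

lemma quad_closed [simp, intro]: "\<theta> \<in> params \<Longrightarrow> y \<in> V \<Longrightarrow> quad \<theta> y \<in> F"
  and slope_closed [simp, intro]: "\<theta> \<in> params \<Longrightarrow> y \<in> V \<Longrightarrow> v \<in> V \<Longrightarrow> slope \<theta> y v \<in> F"
  and lead_closed [simp, intro]: "\<theta> \<in> params \<Longrightarrow> v \<in> V \<Longrightarrow> lead \<theta> v \<in> F"
  by (cases \<theta>; auto simp: params_def)+

lemma quad_line:
  assumes "\<theta> \<in> params" "x \<in> V" "v \<in> normalized_dirs" "t \<in> F"
  shows "quad \<theta> (line_pt x v t) = quad \<theta> x \<oplus> t \<otimes> slope \<theta> x v \<oplus> t \<otimes> (t \<otimes> lead \<theta> v)"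
proof -
  obtain a b c where \<theta>: "\<theta> = (a, b, c)" "a \<in> V" "b \<in> V" "c \<in> F"
    using assms(1) by (auto simp: params_def)
  note v = normalized_dirs_V[OF assms(3)] normalized_dirs_0[OF assms(3)]
  have z: "line_pt x v t 0 = x 0 \<oplus> t"
    using two_le_d v assms by (simp add: line_pt_def vec_add_def vec_smult_def)
  have cl: "dot a x \<in> F" "dot a v \<in> F" "dot b x \<in> F" "dot b v \<in> F" "x 0 \<in> F"
    using \<theta> v assms by auto
  have "quad \<theta> (line_pt x v t) = c \<oplus> (dot b x \<oplus> t \<otimes> dot b v) \<oplus> (x 0 \<oplus> t) \<otimes> (dot a x \<oplus> t \<otimes> dot a v)"
    unfolding \<theta>(1) quad.simps z unfolding line_pt_def
    using \<theta> v assms by (simp add: dot_add_right dot_smult_right)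
  also have "\<dots> = quad \<theta> x \<oplus> t \<otimes> slope \<theta> x v \<oplus> t \<otimes> (t \<otimes> lead \<theta> v)"
    unfolding \<theta>(1) quad.simps slope.simps lead.simps using cl \<theta>(4) assms(4) by algebra
  finally show ?thesis .
qed

lemma add_params_closed: "\<theta> \<in> params \<Longrightarrow> \<theta>' \<in> params \<Longrightarrow> add_params \<theta> \<theta>' \<in> params"
  by (cases \<theta>; cases \<theta>') (auto simp: params_def)

lemma inj_add_params:
  assumes "u \<in> params"
  shows "inj_on (\<lambda>\<theta>. add_params \<theta> u) params"
proof (rule inj_onI)
  fix \<theta> \<theta>' assume *: "\<theta> \<in> params" "\<theta>' \<in> params" "add_params \<theta> u = add_params \<theta>' u"
  obtain a b c where u: "u = (a, b, c)" "a \<in> V" "b \<in> V" "c \<in> F"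
    using assms by (auto simp: params_def)
  obtain a1 b1 c1 where \<theta>: "\<theta> = (a1, b1, c1)" "a1 \<in> V" "b1 \<in> V" "c1 \<in> F"
    using *(1) by (auto simp: params_def)
  obtain a2 b2 c2 where \<theta>': "\<theta>' = (a2, b2, c2)" "a2 \<in> V" "b2 \<in> V" "c2 \<in> F"
    using *(2) by (auto simp: params_def)
  have eqs: "addv a1 a = addv a2 a" "addv b1 b = addv b2 b" "c1 \<oplus> c = c2 \<oplus> c"
    using *(3) unfolding u(1) \<theta>(1) \<theta>'(1) by simp_all
  have "a1 = a2" using addv_right_cancel[OF \<theta>(2) \<theta>'(2) u(2) eqs(1)] .
  moreover have "b1 = b2" using addv_right_cancel[OF \<theta>(3) \<theta>'(3) u(3) eqs(2)] .
  moreover have "c1 = c2" using eqs(3) u(4) \<theta>(4) \<theta>'(4) by simp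
  ultimately show "\<theta> = \<theta>'" unfolding \<theta>(1) \<theta>'(1) by simp
qed

lemma add_4_swap:
  "a \<in> F \<Longrightarrow> b \<in> F \<Longrightarrow> c \<in> F \<Longrightarrow> a' \<in> F \<Longrightarrow> b' \<in> F \<Longrightarrow> c' \<in> F \<Longrightarrow>
   (a \<oplus> a') \<oplus> (b \<oplus> b') \<oplus> (c \<oplus> c') = (a \<oplus> b \<oplus> c) \<oplus> (a' \<oplus> b' \<oplus> c')"
  by (simp add: a_ac)

lemma quad_add:
  assumes "\<theta> \<in> params" "\<theta>' \<in> params" "y \<in> V"
  shows "quad (add_params \<theta> \<theta>') y = quad \<theta> y \<oplus> quad \<theta>' y"
  using assms by (cases \<theta>; cases \<theta>') (simp add: params_def dot_add_left r_distr add_4_swap)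

lemma slope_add:
  assumes "\<theta> \<in> params" "\<theta>' \<in> params" "x \<in> V" "v \<in> V"
  shows "slope (add_params \<theta> \<theta>') x v = slope \<theta> x v \<oplus> slope \<theta>' x v"
  using assms by (cases \<theta>; cases \<theta>') (simp add: params_def dot_add_left r_distr add_4_swap)

lemma lead_add:
  assumes "\<theta> \<in> params" "\<theta>' \<in> params" "v \<in> V"
  shows "lead (add_params \<theta> \<theta>') v = lead \<theta> v \<oplus> lead \<theta>' v"
  using assms by (cases \<theta>; cases \<theta>') (simp add: params_def dot_add_left)

lemma quad_values_surj:
  assumes "y \<in> V" "y' \<in> V" "y \<noteq> y'" "s \<in> F" "s' \<in> F"
  obtains u where "u \<in> params" "quad u y = s" "quad u y' = s'"
proof -
  obtain j where j: "j < d" "y j \<ominus> y' j \<noteq> \<zero>"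
    using differing_coord[OF assms(1-3)] .
  have yj: "y j \<in> F" "y' j \<in> F" using assms j by auto
  define e where "e = y j \<ominus> y' j"
  have e: "e \<in> F" "e \<noteq> \<zero>" "inv e \<in> F" "inv e \<otimes> e = \<one>"
    using j yj by (auto simp: e_def field_Units)
  define \<beta> where "\<beta> = (s \<ominus> s') \<otimes> inv e"
  have \<beta>: "\<beta> \<in> F" "\<beta> \<otimes> e = s \<ominus> s'" using e assms by (auto simp: \<beta>_def m_assoc)
  define \<alpha> where "\<alpha> = s \<ominus> \<beta> \<otimes> y j"
  have \<alpha>: "\<alpha> \<in> F" using \<beta> assms yj by (auto simp: \<alpha>_def)
  \<comment> \<open>The quadratic part is zero: affine functions already separate two points.\<close>
  define u where "u = (axis 0 \<zero>, axis j \<beta>, \<alpha>)"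
  have "quad u w = \<alpha> \<oplus> \<beta> \<otimes> w j" if "w \<in> V" for w
    unfolding u_def using that \<alpha> \<beta> j two_le_d by (simp add: dot_axis)
  then have "quad u y = \<alpha> \<oplus> \<beta> \<otimes> y j" "quad u y' = \<alpha> \<oplus> \<beta> \<otimes> y' j"
    using assms by auto
  moreover have "\<alpha> \<oplus> \<beta> \<otimes> y j = s"
    using assms(4) \<beta>(1) yj unfolding \<alpha>_def by algebra
  moreover have "\<alpha> \<oplus> \<beta> \<otimes> y' j = s'"
  proof -
    have "\<alpha> \<oplus> \<beta> \<otimes> y' j = s \<ominus> \<beta> \<otimes> e"
      unfolding \<alpha>_def e_def using assms(4) \<beta>(1) yj by algebra
    also have "\<dots> = s'" unfolding \<beta>(2) using assms(4,5) by algebra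
    finally show ?thesis .
  qed
  moreover have "u \<in> params" using \<alpha> \<beta> by (auto simp: u_def params_def)
  ultimately show ?thesis using that by metis
qed

text \<open>
  The parameters can be solved for one after another: \<open>a\<close> from the leading coefficients, then \<open>b\<close> from
  the linear ones, then \<open>c\<close> from the value at \<open>x\<close>.
\<close>

lemma line_data_surj:
  assumes "x \<in> V" "v \<in> normalized_dirs" "v' \<in> normalized_dirs" "v \<noteq> v'"
    and "r \<in> F" "l \<in> F" "k \<in> F" "l' \<in> F" "k' \<in> F"
  obtains u where "u \<in> params" "quad u x = r" "slope u x v = l" "lead u v = k"
    "slope u x v' = l'" "lead u v' = k'"
proof -
  note v = normalized_dirs_V[OF assms(2)] normalized_dirs_V[OF assms(3)]
  obtain a where a: "a \<in> V" "dot a v = k" "dot a v' = k'"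
    using dot_pair_surj[OF assms(2-4,7,9)] .
  define w where "w = dot a x"
  have w: "w \<in> F" "x 0 \<in> F" using a assms by (auto simp: w_def)
  have lcl: "l \<ominus> x 0 \<otimes> k \<ominus> w \<in> F" "l' \<ominus> x 0 \<otimes> k' \<ominus> w \<in> F" using assms w by auto
  obtain b where b: "b \<in> V" "dot b v = l \<ominus> x 0 \<otimes> k \<ominus> w" "dot b v' = l' \<ominus> x 0 \<otimes> k' \<ominus> w"
    using dot_pair_surj[OF assms(2-4) lcl] .
  define z where "z = dot b x"
  have z: "z \<in> F" using b assms by (auto simp: z_def)
  define c where "c = r \<ominus> z \<ominus> x 0 \<otimes> w"
  have c: "c \<in> F" using assms w z by (auto simp: c_def)
  show ?thesis
  proof (rule that[of "(a, b, c)"])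
    show "(a, b, c) \<in> params" using a b c by (auto simp: params_def)
    show "lead (a, b, c) v = k" "lead (a, b, c) v' = k'" using a by auto
    show "quad (a, b, c) x = r"
      unfolding quad.simps w_def[symmetric] z_def[symmetric] c_def using assms(5) w z by algebra
    show "slope (a, b, c) x v = l"
      unfolding slope.simps a b w_def[symmetric] using assms(6,7) w by algebra
    show "slope (a, b, c) x v' = l'"
      unfolding slope.simps a b w_def[symmetric] using assms(8,9) w by algebra
  qed
qed

lemma add_minus_cancel: "s \<in> F \<Longrightarrow> t \<in> F \<Longrightarrow> s \<oplus> (t \<ominus> s) = t"
  by algebra

lemma quad_values_uniform:
  assumes "y \<in> V" "y' \<in> V" "y \<noteq> y'" "S \<subseteq> F \<times> F"
  shows "card {\<theta>\<in>params. (quad \<theta> y, quad \<theta> y') \<in> S} * q\<^sup>2 = card S * card params"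
proof -
  have "card {\<theta>\<in>params. (quad \<theta> y, quad \<theta> y') \<in> S} * card (F \<times> F) = card S * card params"
  proof (rule card_preimage_uniform_fibres)
    fix s t assume st: "s \<in> F \<times> F" "t \<in> F \<times> F"
    obtain u where u: "u \<in> params" "quad u y = fst t \<ominus> fst s" "quad u y' = snd t \<ominus> snd s"
      by (rule quad_values_surj[OF assms(1-3), of "fst t \<ominus> fst s" "snd t \<ominus> snd s"]) (use st in auto)
    show "\<exists>g. inj_on g params \<and> g \<in> params \<rightarrow> params \<and>
        (\<forall>\<theta>\<in>params. (quad \<theta> y, quad \<theta> y') = s \<longrightarrow> (quad (g \<theta>) y, quad (g \<theta>) y') = t)"
      using st u assms
      by (intro exI[of _ "\<lambda>\<theta>. add_params \<theta> u"])
        (auto simp: inj_add_params add_params_closed quad_add add_minus_cancel)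
  qed (use assms in auto)
  then show ?thesis by (simp add: card_cartesian_product power2_eq_square)
qed

text \<open>
  For a random quadric, its value at \<open>x\<close> and the two other coefficients on two distinct lines through \<open>x\<close> are
  five independent uniform elements of the field. All pairwise independence used at \<open>x\<close> comes from this.
\<close>

lemma line_data_uniform:
  assumes "x \<in> V" "v \<in> normalized_dirs" "v' \<in> normalized_dirs" "v \<noteq> v'"
    and "S \<subseteq> F \<times> (F \<times> F) \<times> (F \<times> F)"
  shows "card {\<theta>\<in>params. (quad \<theta> x, (slope \<theta> x v, lead \<theta> v), (slope \<theta> x v', lead \<theta> v')) \<in> S} * q ^ 5
    = card S * card params"
proof -
  note v = normalized_dirs_V[OF assms(2)] normalized_dirs_V[OF assms(3)]
  have "card {\<theta>\<in>params. (quad \<theta> x, (slope \<theta> x v, lead \<theta> v), (slope \<theta> x v', lead \<theta> v')) \<in> S}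
      * card (F \<times> (F \<times> F) \<times> (F \<times> F)) = card S * card params"
  proof (rule card_preimage_uniform_fibres)
    fix s t assume st: "s \<in> F \<times> (F \<times> F) \<times> (F \<times> F)" "t \<in> F \<times> (F \<times> F) \<times> (F \<times> F)"
    obtain r l k l' k' where s: "s = (r, (l, k), (l', k'))" "r \<in> F" "l \<in> F" "k \<in> F" "l' \<in> F" "k' \<in> F"
      using st by auto
    obtain r2 l2 k2 l2' k2' where t: "t = (r2, (l2, k2), (l2', k2'))"
        "r2 \<in> F" "l2 \<in> F" "k2 \<in> F" "l2' \<in> F" "k2' \<in> F"
      using st by auto
    obtain u where u: "u \<in> params" "quad u x = r2 \<ominus> r" "slope u x v = l2 \<ominus> l" "lead u v = k2 \<ominus> k"
        "slope u x v' = l2' \<ominus> l'" "lead u v' = k2' \<ominus> k'"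
      by (rule line_data_surj[OF assms(1-4), of "r2 \<ominus> r" "l2 \<ominus> l" "k2 \<ominus> k" "l2' \<ominus> l'" "k2' \<ominus> k'"])
        (use s t in auto)
    show "\<exists>g. inj_on g params \<and> g \<in> params \<rightarrow> params \<and>
        (\<forall>\<theta>\<in>params. (quad \<theta> x, (slope \<theta> x v, lead \<theta> v), (slope \<theta> x v', lead \<theta> v')) = s \<longrightarrow>
          (quad (g \<theta>) x, (slope (g \<theta>) x v, lead (g \<theta>) v), (slope (g \<theta>) x v', lead (g \<theta>) v')) = t)"
      using s t u assms(1) v
      by (intro exI[of _ "\<lambda>\<theta>. add_params \<theta> u"])
        (auto simp: inj_add_params add_params_closed quad_add slope_add lead_add add_minus_cancel)
  qed (use assms v in auto)
  then show ?thesis by (simp add: card_cartesian_product numeral_eq_Suc mult_ac)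
qed

section \<open>Quadratics in one variable without roots\<close>

lemma q_ge_2: "2 \<le> q"
proof -
  have "card {\<zero>, \<one>} \<le> q" by (intro card_mono) auto
  then show ?thesis using zero_not_one by simp
qed

lemma two_card_ordered_pairs: "2 * card {(x, y) \<in> F \<times> F. x \<le> y} = q * q + q"
proof -
  let ?U = "{(x, y) \<in> F \<times> F. x \<le> y}" and ?L = "{(x, y) \<in> F \<times> F. y \<le> x}"
  have fin: "finite ?U" "finite ?L"
    by (rule finite_subset[of _ "F \<times> F"]; auto)+
  have L: "?L = prod.swap ` ?U" by auto
  have "card ?L = card ?U" unfolding L by (intro card_image) (auto simp: inj_on_def)
  moreover have "card ?U + card ?L = card (?U \<union> ?L) + card (?U \<inter> ?L)" using card_Un_Int[OF fin] .
  moreover have "?U \<union> ?L = F \<times> F" by auto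
  moreover have "?U \<inter> ?L = (\<lambda>x. (x, x)) ` F" by auto
  then have "card (?U \<inter> ?L) = q" by (simp add: card_image inj_on_def)
  ultimately show ?thesis by (simp add: card_cartesian_product)
qed

text \<open>
  The pairs \<open>(l, k)\<close> for which \<open>c + l t + k t\<^sup>2\<close> has no root if \<open>c \<noteq> 0\<close>, and is not identically zero, so that
  it has at most one root \<open>t \<noteq> 0\<close>, if \<open>c = 0\<close>.
\<close>

definition tame_pairs :: "'a \<Rightarrow> ('a \<times> 'a) set" where
  "tame_pairs c = (if c = \<zero> then F \<times> F - {(\<zero>, \<zero>)}
     else {(l, k) \<in> F \<times> F. \<forall>t\<in>F. c \<oplus> t \<otimes> l \<oplus> t \<otimes> (t \<otimes> k) \<noteq> \<zero>})"

lemma tame_pairs_subset: "tame_pairs c \<subseteq> F \<times> F"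
  by (auto simp: tame_pairs_def)

lemma quadratic_with_root_factors:
  assumes c: "c \<in> F" "c \<noteq> \<zero>" and lk: "l \<in> F" "k \<in> F" and t: "t \<in> F"
    and root: "c \<oplus> t \<otimes> l \<oplus> t \<otimes> (t \<otimes> k) = \<zero>"
  obtains \<alpha> \<beta> where "\<alpha> \<in> F" "\<beta> \<in> F" "l = \<ominus> (c \<otimes> (\<alpha> \<oplus> \<beta>))" "k = c \<otimes> (\<alpha> \<otimes> \<beta>)"
proof -
  have "t \<noteq> \<zero>" using root c lk by auto
  define \<alpha> where "\<alpha> = inv t"
  define ci where "ci = inv c"
  have \<alpha>: "\<alpha> \<in> F" "\<alpha> \<otimes> t = \<one>" using \<open>t \<noteq> \<zero>\<close> t by (auto simp: \<alpha>_def field_Units)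
  have ci: "ci \<in> F" "ci \<otimes> c = \<one>" using c by (auto simp: ci_def field_Units)
  define \<beta> where "\<beta> = \<ominus> (ci \<otimes> l) \<ominus> \<alpha>"
  have \<beta>: "\<beta> \<in> F" using \<alpha> ci lk by (auto simp: \<beta>_def)
  have "\<ominus> (c \<otimes> (\<alpha> \<oplus> \<beta>)) = (ci \<otimes> c) \<otimes> l"
    unfolding \<beta>_def using \<alpha>(1) ci(1) c(1) lk by algebra
  then have l: "l = \<ominus> (c \<otimes> (\<alpha> \<oplus> \<beta>))" using ci lk by simp
  have "c \<otimes> (\<alpha> \<otimes> \<beta>) = \<ominus> (\<alpha> \<otimes> ((ci \<otimes> c) \<otimes> l)) \<ominus> \<alpha> \<otimes> (\<alpha> \<otimes> c)"
    unfolding \<beta>_def using \<alpha>(1) ci(1) c(1) lk by algebra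
  also have "\<dots> = \<ominus> (\<alpha> \<otimes> l) \<ominus> \<alpha> \<otimes> (\<alpha> \<otimes> c)" using ci lk by simp
  also have "\<dots> = \<ominus> (\<alpha> \<otimes> l) \<ominus> \<alpha> \<otimes> (\<alpha> \<otimes> c) \<oplus> \<alpha> \<otimes> (\<alpha> \<otimes> (c \<oplus> t \<otimes> l \<oplus> t \<otimes> (t \<otimes> k)))"
    unfolding root using \<alpha>(1) c(1) lk by simp
  also have "\<dots> = \<ominus> (\<alpha> \<otimes> l) \<oplus> \<alpha> \<otimes> ((\<alpha> \<otimes> t) \<otimes> l) \<oplus> (\<alpha> \<otimes> t) \<otimes> ((\<alpha> \<otimes> t) \<otimes> k)"
    using \<alpha>(1) c(1) lk t by algebra
  also have "\<dots> = k" unfolding \<alpha>(2) using \<alpha>(1) lk by (simp add: l_neg)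
  finally show ?thesis using that[OF \<alpha>(1) \<beta> l] by simp
qed

text \<open>
  For \<open>c \<noteq> 0\<close>, a quadratic with a root is \<open>c (1 - \<alpha> t) (1 - \<beta> t)\<close> for some unordered pair \<open>{\<alpha>, \<beta>}\<close>
  with repetition allowed, and there are \<open>q (q + 1) / 2\<close> of these, so about half of the \<open>q\<^sup>2\<close> quadratics remain. The linear order on the
  carrier serves only to name each unordered pair by an ordered one.
\<close>

lemma card_tame_pairs_ge:
  assumes c: "c \<in> F"
  shows "q * (q - 1) \<le> 2 * card (tame_pairs c)"
proof (cases "c = \<zero>")
  case True
  then have "card (tame_pairs c) = q * q - 1"
    by (simp add: tame_pairs_def card_Diff_singleton card_cartesian_product)
  moreover have "1 \<le> q" "q \<le> q * q" using q_ge_2 by auto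
  ultimately show ?thesis by (simp add: diff_mult_distrib2)
next
  case False
  define P where "P = {(x, y) \<in> F \<times> F. x \<le> y}"
  define f where "f = (\<lambda>(\<alpha>, \<beta>). (\<ominus> (c \<otimes> (\<alpha> \<oplus> \<beta>)), c \<otimes> (\<alpha> \<otimes> \<beta>)))"
  have finP: "finite P" unfolding P_def by (rule finite_subset[of _ "F \<times> F"]) auto
  have "F \<times> F - tame_pairs c \<subseteq> f ` P"
  proof
    fix z assume z: "z \<in> F \<times> F - tame_pairs c"
    then obtain l k where lk: "z = (l, k)" "l \<in> F" "k \<in> F" by auto
    then obtain t where t: "t \<in> F" "c \<oplus> t \<otimes> l \<oplus> t \<otimes> (t \<otimes> k) = \<zero>"
      using z False by (auto simp: tame_pairs_def)
    obtain \<alpha> \<beta> where ab: "\<alpha> \<in> F" "\<beta> \<in> F" "l = \<ominus> (c \<otimes> (\<alpha> \<oplus> \<beta>))" "k = c \<otimes> (\<alpha> \<otimes> \<beta>)"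
      using quadratic_with_root_factors[OF c False lk(2,3) t] .
    have "z = f (\<alpha>, \<beta>)" "z = f (\<beta>, \<alpha>)"
      unfolding f_def lk(1) ab using ab(1,2) by (simp_all add: a_comm m_comm)
    moreover have "(\<alpha>, \<beta>) \<in> P \<or> (\<beta>, \<alpha>) \<in> P" using ab by (auto simp: P_def)
    ultimately show "z \<in> f ` P" by blast
  qed
  then have "card (F \<times> F - tame_pairs c) \<le> card P"
    using card_mono[of "f ` P"] card_image_le[OF finP, of f] finP by (meson finite_imageI order_trans)
  moreover have "card (F \<times> F - tame_pairs c) = q * q - card (tame_pairs c)"
    using card_Diff_subset[OF finite_subset[OF tame_pairs_subset] tame_pairs_subset, of c]
    by (simp add: card_cartesian_product)
  ultimately have "2 * (q * q) \<le> 2 * card (tame_pairs c) + (q * q + q)"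
    using two_card_ordered_pairs unfolding P_def by linarith
  then show ?thesis by (simp add: diff_mult_distrib2)
qed

text \<open>
  Cutting all the sets \<open>tame_pairs c\<close> down to one common size makes the event \<open>(l, k) \<in> chosen_pairs c\<close>
  equally likely for every \<open>c\<close>. Then these events for two lines through \<open>x\<close>, which share the value
  \<open>c\<close> at \<open>x\<close>, are independent without conditioning on that value.
\<close>

definition chosen_pairs :: "'a \<Rightarrow> ('a \<times> 'a) set" where
  "chosen_pairs c = (SOME G. G \<subseteq> tame_pairs c \<and> card G = q * (q - 1) div 2)"

lemma chosen_pairs:
  assumes "c \<in> F"
  shows "chosen_pairs c \<subseteq> tame_pairs c" "2 * card (chosen_pairs c) = q * (q - 1)"
proof -
  have "q * (q - 1) div 2 \<le> card (tame_pairs c)" using card_tame_pairs_ge[OF assms] by linarith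
  then have "\<exists>G. G \<subseteq> tame_pairs c \<and> card G = q * (q - 1) div 2"
    using obtain_subset_with_card_n by metis
  then have "chosen_pairs c \<subseteq> tame_pairs c \<and> card (chosen_pairs c) = q * (q - 1) div 2"
    unfolding chosen_pairs_def by (rule someI_ex)
  moreover have "even (q * (q - 1))" by (cases "even q") auto
  ultimately show "chosen_pairs c \<subseteq> tame_pairs c" "2 * card (chosen_pairs c) = q * (q - 1)" by auto
qed

lemma chosen_pairs_subset: "c \<in> F \<Longrightarrow> chosen_pairs c \<subseteq> F \<times> F"
  using chosen_pairs(1) tame_pairs_subset by blast

definition chosen :: "(nat \<Rightarrow> 'a) \<times> (nat \<Rightarrow> 'a) \<times> 'a \<Rightarrow> (nat \<Rightarrow> 'a) \<Rightarrow> (nat \<Rightarrow> 'a) \<Rightarrow> bool" where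
  "chosen \<theta> x v \<longleftrightarrow> (slope \<theta> x v, lead \<theta> v) \<in> chosen_pairs (quad \<theta> x)"

lemma chosen_avoids:
  assumes "\<theta> \<in> params" "x \<in> V" "v \<in> normalized_dirs" "chosen \<theta> x v" "quad \<theta> x \<noteq> \<zero>" "t \<in> F"
  shows "quad \<theta> (line_pt x v t) \<noteq> \<zero>"
proof -
  have "(slope \<theta> x v, lead \<theta> v) \<in> tame_pairs (quad \<theta> x)"
    using assms chosen_pairs(1)[of "quad \<theta> x"] by (auto simp: chosen_def)
  then show ?thesis using assms by (auto simp: tame_pairs_def quad_line)
qed

lemma chosen_meets_once:
  assumes "\<theta> \<in> params" "x \<in> V" "v \<in> normalized_dirs" "chosen \<theta> x v" "quad \<theta> x = \<zero>"
    and t: "t \<in> F" "t \<noteq> \<zero>" "quad \<theta> (line_pt x v t) = \<zero>"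
    and s: "s \<in> F" "s \<noteq> \<zero>" "quad \<theta> (line_pt x v s) = \<zero>"
  shows "t = s"
proof (rule ccontr)
  assume "t \<noteq> s"
  define l k where "l = slope \<theta> x v" and "k = lead \<theta> v"
  have lk: "l \<in> F" "k \<in> F"
    unfolding l_def k_def using assms normalized_dirs_V by auto
  have "(l, k) \<in> tame_pairs \<zero>"
    using assms chosen_pairs(1)[of "\<zero>"] by (auto simp: chosen_def l_def k_def)
  then have nz: "l \<noteq> \<zero> \<or> k \<noteq> \<zero>" by (auto simp: tame_pairs_def)
  have lin: "l \<oplus> r \<otimes> k = \<zero>" if "r \<in> F" "r \<noteq> \<zero>" "quad \<theta> (line_pt x v r) = \<zero>" for r
  proof -
    have "\<zero> = \<zero> \<oplus> r \<otimes> l \<oplus> r \<otimes> (r \<otimes> k)"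
      using quad_line[OF assms(1-3) that(1)] that(3) assms(5) by (simp add: l_def k_def)
    also have "\<dots> = r \<otimes> (l \<oplus> r \<otimes> k)" using that lk by algebra
    finally show ?thesis using that lk integral[of r "l \<oplus> r \<otimes> k"] by auto
  qed
  have "(t \<ominus> s) \<otimes> k = (l \<oplus> t \<otimes> k) \<ominus> (l \<oplus> s \<otimes> k)" using t(1) s(1) lk by algebra
  also have "\<dots> = \<zero>" unfolding lin[OF t] lin[OF s] by simp
  finally have "k = \<zero>" using \<open>t \<noteq> s\<close> t s lk integral[of "t \<ominus> s" k] by auto
  then show False using nz lin[OF t] lk t by simp
qed

definition tame_prob :: real where
  "tame_prob = (real q - 1) / (2 * real q)"

lemma q_real: "2 \<le> real q" "0 < real q" "real q \<noteq> 0"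
  using q_ge_2 by auto

lemma real_card_chosen_pairs:
  assumes "c \<in> F" shows "real (card (chosen_pairs c)) = tame_prob * real q ^ 2"
proof -
  have "2 * real (card (chosen_pairs c)) = real (q * (q - 1))"
    unfolding chosen_pairs(2)[OF assms, symmetric] by simp
  also have "\<dots> = real q * (real q - 1)" using q_ge_2 by (simp add: of_nat_diff)
  finally have "real (card (chosen_pairs c)) = real q * (real q - 1) / 2" by linarith
  then show ?thesis using q_real by (simp add: tame_prob_def power2_eq_square)
qed

lemma card_chosen2:
  assumes "x \<in> V" "v \<in> normalized_dirs" "v' \<in> normalized_dirs" "v \<noteq> v'"
  shows "real (card {\<theta>\<in>params. chosen \<theta> x v \<and> chosen \<theta> x v'}) = tame_prob\<^sup>2 * real (card params)"
proof -
  define S where "S = (SIGMA c:F. chosen_pairs c \<times> chosen_pairs c)"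
  have sub: "S \<subseteq> F \<times> (F \<times> F) \<times> (F \<times> F)" unfolding S_def using chosen_pairs_subset by blast
  have fin: "finite (chosen_pairs c)" if "c \<in> F" for c
    using finite_subset[OF chosen_pairs_subset[OF that]] by simp
  have "card S = (\<Sum>c\<in>F. card (chosen_pairs c \<times> chosen_pairs c))"
    unfolding S_def using fin by (intro card_SigmaI) auto
  then have "real (card S) = (\<Sum>c\<in>F. (tame_prob * real q ^ 2)\<^sup>2)"
    by (simp add: card_cartesian_product real_card_chosen_pairs power2_eq_square)
  then have cS: "real (card S) = tame_prob\<^sup>2 * real q ^ 5"
    by (simp add: power_mult_distrib numeral_eq_Suc)
  have eq: "{\<theta>\<in>params. chosen \<theta> x v \<and> chosen \<theta> x v'} =
    {\<theta>\<in>params. (quad \<theta> x, (slope \<theta> x v, lead \<theta> v), (slope \<theta> x v', lead \<theta> v')) \<in> S}"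
    using assms(1) by (auto simp: S_def chosen_def)
  show ?thesis unfolding eq
    using cS q_ge_2 by (intro density_of_count[OF line_data_uniform[OF assms sub]]) simp_all
qed

lemma card_chosen1:
  assumes "x \<in> V" "v \<in> normalized_dirs"
  shows "real (card {\<theta>\<in>params. chosen \<theta> x v}) = tame_prob * real (card params)"
proof -
  \<comment> \<open>The distribution on one line is a marginal of the joint distribution on two lines.\<close>
  have "card normalized_dirs \<ge> 2"
    unfolding card_normalized_dirs using q_ge_2 two_le_d self_le_power[of q "d - 1"] by linarith
  then obtain v' where v': "v' \<in> normalized_dirs" "v \<noteq> v'"
    by (metis card_2_iff' assms(2) card_le_Suc0_iff_eq card_eq_0_iff not_less_eq_eq numeral_2_eq_2 zero_neq_numeral le_zero_eq)
  define S where "S = (SIGMA c:F. chosen_pairs c \<times> (F \<times> F))"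
  have sub: "S \<subseteq> F \<times> (F \<times> F) \<times> (F \<times> F)" unfolding S_def using chosen_pairs_subset by blast
  have fin: "finite (chosen_pairs c)" if "c \<in> F" for c
    using finite_subset[OF chosen_pairs_subset[OF that]] by simp
  have "card S = (\<Sum>c\<in>F. card (chosen_pairs c \<times> (F \<times> F)))"
    unfolding S_def using fin by (intro card_SigmaI) auto
  then have "real (card S) = (\<Sum>c\<in>F. (tame_prob * real q ^ 2) * real q ^ 2)"
    by (simp add: card_cartesian_product real_card_chosen_pairs power2_eq_square)
  then have cS: "real (card S) = tame_prob * real q ^ 5"
    by (simp add: power_mult_distrib numeral_eq_Suc)
  have eq: "{\<theta>\<in>params. chosen \<theta> x v} =
    {\<theta>\<in>params. (quad \<theta> x, (slope \<theta> x v, lead \<theta> v), (slope \<theta> x v', lead \<theta> v')) \<in> S}"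
    using assms v'(1) normalized_dirs_V by (auto simp: S_def chosen_def)
  show ?thesis unfolding eq
    using cS q_ge_2 by (intro density_of_count[OF line_data_uniform[OF assms v' sub]]) simp_all
qed

lemma card_nonzero2:
  assumes "y \<in> V" "y' \<in> V" "y \<noteq> y'"
  shows "real (card {\<theta>\<in>params. quad \<theta> y \<noteq> \<zero> \<and> quad \<theta> y' \<noteq> \<zero>}) = (1 - 1 / real q)\<^sup>2 * real (card params)"
proof -
  define S where "S = (F - {\<zero>}) \<times> (F - {\<zero>})"
  have sub: "S \<subseteq> F \<times> F" unfolding S_def by auto
  have "real (card S) = (real q - 1)\<^sup>2"
    using q_ge_2 unfolding S_def
    by (simp add: card_cartesian_product card_Diff_singleton of_nat_diff power2_eq_square)
  then have cS: "real (card S) = (1 - 1 / real q)\<^sup>2 * (real q)\<^sup>2"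
    using q_real by (simp add: power_mult_distrib[symmetric] field_simps)
  have eq: "{\<theta>\<in>params. quad \<theta> y \<noteq> \<zero> \<and> quad \<theta> y' \<noteq> \<zero>} = {\<theta>\<in>params. (quad \<theta> y, quad \<theta> y') \<in> S}"
    using assms by (auto simp: S_def)
  show ?thesis unfolding eq
    using cS q_ge_2 by (intro density_of_count[OF quad_values_uniform[OF assms sub]]) simp_all
qed

lemma card_zero1:
  assumes "y \<in> V"
  shows "real (card {\<theta>\<in>params. quad \<theta> y = \<zero>}) = 1 / real q * real (card params)"
proof -
  have "2 \<le> q ^ d" using q_ge_2 two_le_d self_le_power[of q d] by linarith
  then have "2 \<le> card V" unfolding card_V .
  then obtain y' where y': "y' \<in> V" "y \<noteq> y'"
    by (metis card_2_iff' assms card_le_Suc0_iff_eq card_eq_0_iff not_less_eq_eq numeral_2_eq_2 zero_neq_numeral le_zero_eq)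
  define S where "S = {\<zero>} \<times> F"
  have sub: "S \<subseteq> F \<times> F" unfolding S_def by auto
  have cS: "real (card S) = 1 / real q * (real q)\<^sup>2"
    unfolding S_def using q_real by (simp add: card_cartesian_product power2_eq_square)
  have eq: "{\<theta>\<in>params. quad \<theta> y = \<zero>} = {\<theta>\<in>params. (quad \<theta> y, quad \<theta> y') \<in> S}"
    using assms y' by (auto simp: S_def)
  show ?thesis unfolding eq
    using cS q_ge_2 by (intro density_of_count[OF quad_values_uniform[OF assms y' sub]]) simp_all
qed

lemma card_nonzero1:
  assumes "y \<in> V"
  shows "real (card {\<theta>\<in>params. quad \<theta> y \<noteq> \<zero>}) = (1 - 1 / real q) * real (card params)"
proof -
  have "card params = card {\<theta>\<in>params. quad \<theta> y = \<zero>} + card {\<theta>\<in>params. quad \<theta> y \<noteq> \<zero>}"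
    by (subst card_Un_disjoint[symmetric]) (auto intro!: arg_cong[where f = card])
  then have "real (card params)
      = real (card {\<theta>\<in>params. quad \<theta> y = \<zero>}) + real (card {\<theta>\<in>params. quad \<theta> y \<noteq> \<zero>})"
    by linarith
  then show ?thesis using card_zero1[OF assms] by (simp add: algebra_simps)
qed

section \<open>Several independent quadrics\<close>

definition samples :: "nat \<Rightarrow> (nat \<Rightarrow> (nat \<Rightarrow> 'a) \<times> (nat \<Rightarrow> 'a) \<times> 'a) set" where
  "samples m = {..<m} \<rightarrow>\<^sub>E params"

definition zeros :: "nat \<Rightarrow> (nat \<Rightarrow> (nat \<Rightarrow> 'a) \<times> (nat \<Rightarrow> 'a) \<times> 'a) \<Rightarrow> (nat \<Rightarrow> 'a) set" where
  "zeros m \<omega> = {y \<in> V. \<exists>i<m. quad (\<omega> i) y = \<zero>}"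

definition good_dirs where
  "good_dirs m \<omega> x = {v \<in> normalized_dirs. \<forall>i<m. chosen (\<omega> i) x v}"

text \<open>
  The expected number of good directions is \<open>tame_prob ^ m * q ^ (d - 1)\<close>; a point is bad if it has less than half
  of this, or if it lies on two of the quadrics, when its lines may meet their union twice.
\<close>

definition bad_points where
  "bad_points m \<omega> = {x \<in> V. (\<exists>i<m. \<exists>j<m. i \<noteq> j \<and> quad (\<omega> i) x = \<zero> \<and> quad (\<omega> j) x = \<zero>)
     \<or> real (card (good_dirs m \<omega> x)) < tame_prob ^ m * real q ^ (d - 1) / 2}"

lemma finite_samples [simp]: "finite (samples m)"
  unfolding samples_def by (intro finite_PiE) auto

lemma samples_mem: "\<omega> \<in> samples m \<Longrightarrow> i < m \<Longrightarrow> \<omega> i \<in> params"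
  unfolding samples_def by auto

lemma card_params_pos: "0 < card params"
proof -
  have "\<zero> \<in> F" "axis 0 \<zero> \<in> V" by auto
  then have "params \<noteq> {}" unfolding params_def by blast
  then show ?thesis by (simp add: card_gt_0_iff)
qed

lemma card_samples_pos: "0 < card (samples m)"
  unfolding samples_def using card_params_pos by (simp add: card_PiE)

lemma finite_normalized_dirs [simp]: "finite normalized_dirs"
  by (rule finite_subset[of _ V]) (auto simp: normalized_dirs_def)

lemma tame_prob_pos: "0 < tame_prob" 
  using q_real by (simp add: tame_prob_def)

text \<open>
  The values of a random quadric at two distinct points are independent, so the number of points outside all
  quadrics has variance at most \<open>q ^ d\<close>, which is at most half the square of \<open>q ^ (d - 1)\<close> since \<open>d \<ge> 3\<close>.
\<close>

lemma few_small_zero_sets: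
  assumes "3 \<le> d"
  shows "real (card {\<omega> \<in> samples m. real (card (zeros m \<omega>)) < real q ^ d * (1 - (1 - 1 / real q) ^ m) - real q ^ (d - 1)})
    \<le> real (card (samples m)) / 2"
proof -
  define A where "A = (\<lambda>y (\<omega>::nat \<Rightarrow> (nat \<Rightarrow> 'a) \<times> (nat \<Rightarrow> 'a) \<times> 'a). \<forall>i<m. quad (\<omega> i) y \<noteq> \<zero>)"
  define p where "p = (1 - 1 / real q) ^ m"
  have p: "p \<le> 1" unfolding p_def using q_real by (intro power_le_one) auto
  define S where "S = {\<omega>\<in>samples m. real q ^ (d - 1) \<le> \<bar>real (card {y\<in>V. A y \<omega>}) - p * real (card V)\<bar>}"
  have "real (card S) * (real q ^ (d - 1))\<^sup>2 \<le> p * real (card V) * real (card (samples m))"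
    unfolding S_def
  proof (rule chebyshev_count)
    show "0 < real q ^ (d - 1)" using q_real by simp
    show "real (card {\<omega>\<in>samples m. A y \<omega>}) = p * real (card (samples m))" if "y \<in> V" for y
      unfolding A_def p_def samples_def by (rule card_iid_real[OF card_nonzero1[OF that]])
    show "real (card {\<omega>\<in>samples m. A y \<omega> \<and> A y' \<omega>}) = p\<^sup>2 * real (card (samples m))"
      if "y \<in> V" "y' \<in> V" "y \<noteq> y'" for y y'
      using card_iid_real[OF card_nonzero2[OF that], of m]
      unfolding A_def p_def samples_def power_mult[symmetric]
      by (simp only: power_mult[symmetric] mult.commute[of m 2] all_conj_distrib imp_conjR)
  qed auto
  also have "\<dots> \<le> real q ^ d * real (card (samples m))"
    using p mult_right_mono[of p 1 "real q ^ d"] unfolding card_V by (intro mult_right_mono) auto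
  finally have 1: "real (card S) * (real q ^ (d - 1))\<^sup>2 \<le> real q ^ d * real (card (samples m))" .
  have "2 * real q ^ d \<le> real q ^ (d - 2) * real q ^ d"
  proof (intro mult_right_mono)
    \<comment> \<open>This is where dimension at least three is needed: the standard deviation is then below the allowed deviation.\<close>
    show "2 \<le> real q ^ (d - 2)"
    proof -
      have "real q ^ 1 \<le> real q ^ (d - 2)" using q_real(1) assms by (intro power_increasing) linarith+
      then show ?thesis using q_real(1) unfolding power_one_right by (rule order_trans[rotated])
    qed
  qed simp
  also have "\<dots> = (real q ^ (d - 1))\<^sup>2"
  proof -
    have "(d - 2) + d = (d - 1) * 2" using assms by linarith
    then show ?thesis unfolding power_add[symmetric] power_mult[symmetric] by (rule arg_cong)
  qed
  finally have "real (card S) * (2 * real q ^ d) \<le> real q ^ d * real (card (samples m))"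
    using 1 by (meson mult_left_mono of_nat_0_le_iff order_trans)
  then have S: "real (card S) \<le> real (card (samples m)) / 2"
    using q_real by (simp add: mult.commute mult.left_commute)
  have "{\<omega> \<in> samples m. real (card (zeros m \<omega>)) < real q ^ d * (1 - (1 - 1 / real q) ^ m) - real q ^ (d - 1)} \<subseteq> S"
  proof
    fix \<omega> assume w: "\<omega> \<in> {\<omega> \<in> samples m. real (card (zeros m \<omega>)) < real q ^ d * (1 - (1 - 1 / real q) ^ m) - real q ^ (d - 1)}"
    have "{y\<in>V. A y \<omega>} = V - zeros m \<omega>" unfolding A_def zeros_def by blast
    then have "card {y\<in>V. A y \<omega>} = q ^ d - card (zeros m \<omega>)"
      by (simp add: card_Diff_subset zeros_def card_V)
    moreover have "card (zeros m \<omega>) \<le> q ^ d"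
      unfolding card_V[symmetric] zeros_def by (intro card_mono) auto
    ultimately have "real (card {y\<in>V. A y \<omega>}) = real q ^ d - real (card (zeros m \<omega>))"
      by (simp add: of_nat_diff)
    then have "real q ^ (d - 1) \<le> real (card {y\<in>V. A y \<omega>}) - p * real (card V)"
      using w unfolding card_V p_def by (simp add: algebra_simps)
    then show "\<omega> \<in> S" using w unfolding S_def by auto
  qed
  then have "card {\<omega> \<in> samples m. real (card (zeros m \<omega>)) < real q ^ d * (1 - (1 - 1 / real q) ^ m) - real q ^ (d - 1)} \<le> card S"
    by (intro card_mono) (auto simp: S_def)
  then show ?thesis using S by linarith
qed

text \<open>
  The first summand is the union bound over pairs of quadrics through \<open>x\<close>, each pair having probability
  \<open>1 / q\<^sup>2\<close>; the second is Chebyshev's inequality for the number of good directions.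
\<close>

lemma card_bad_samples:
  assumes x: "x \<in> V"
  shows "real (card {\<omega> \<in> samples m. x \<in> bad_points m \<omega>})
    \<le> ((real m / real q)\<^sup>2 + 4 / (tame_prob ^ m * real q ^ (d - 1))) * real (card (samples m))"
proof -
  define T where "T = (\<lambda>(i, j). {\<omega> \<in> samples m. quad (\<omega> i) x = \<zero> \<and> quad (\<omega> j) x = \<zero>})"
  define I where "I = {(i, j) \<in> {..<m} \<times> {..<m}. i \<noteq> j}"
  have finI: "finite I" unfolding I_def by (rule finite_subset[of _ "{..<m} \<times> {..<m}"]) auto
  have "card I \<le> card ({..<m} \<times> {..<m})" unfolding I_def by (intro card_mono) auto
  then have cI: "real (card I) \<le> (real m)\<^sup>2"
    by (simp add: card_cartesian_product power2_eq_square flip: of_nat_mult)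
  have T: "real (card (T z)) = (1 / real q)\<^sup>2 * real (card (samples m))" if z: "z \<in> I" for z
  proof -
    obtain i j where ij: "z = (i, j)" "i < m" "j < m" "i \<noteq> j" using z by (auto simp: I_def)
    show ?thesis unfolding T_def ij(1) prod.case samples_def
    proof (rule density_of_count[OF card_two_coordinates[OF ij(2-4)]])
      show "real ((card {\<theta>\<in>params. quad \<theta> x = \<zero>})\<^sup>2) = (1 / real q)\<^sup>2 * real ((card params)\<^sup>2)"
        using card_zero1[OF x] by (simp add: power_divide)
    qed (use card_params_pos in simp)
  qed
  have "real (card (\<Union>z\<in>I. T z)) \<le> real (\<Sum>z\<in>I. card (T z))"
    using card_UN_le[OF finI, of T] by (simp only: of_nat_le_iff)
  also have "\<dots> = real (card I) * ((1 / real q)\<^sup>2 * real (card (samples m)))"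
    by (simp add: T)
  also have "\<dots> \<le> (real m)\<^sup>2 * ((1 / real q)\<^sup>2 * real (card (samples m)))"
    using cI by (intro mult_right_mono) auto
  finally have 1: "real (card (\<Union>z\<in>I. T z)) \<le> (real m / real q)\<^sup>2 * real (card (samples m))"
    by (simp add: power_divide)
  define p where "p = tame_prob ^ m"
  define A where "A = (\<lambda>v (\<omega>::nat \<Rightarrow> (nat \<Rightarrow> 'a) \<times> (nat \<Rightarrow> 'a) \<times> 'a). \<forall>i<m. chosen (\<omega> i) x v)"
  define h where "h = p * real q ^ (d - 1)"
  have h: "0 < h" using tame_prob_pos q_real by (simp add: h_def p_def)
  have K: "real (card normalized_dirs) = real q ^ (d - 1)" by (simp add: card_normalized_dirs)
  define S where "S = {\<omega>\<in>samples m. h / 2 \<le> \<bar>real (card {v\<in>normalized_dirs. A v \<omega>}) - p * real (card normalized_dirs)\<bar>}"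
  have "real (card S) * (h / 2)\<^sup>2 \<le> p * real (card normalized_dirs) * real (card (samples m))"
    unfolding S_def
  proof (rule chebyshev_count)
    show "0 < h / 2" using h by simp
    show "real (card {\<omega>\<in>samples m. A v \<omega>}) = p * real (card (samples m))" if "v \<in> normalized_dirs" for v
      unfolding A_def p_def samples_def by (rule card_iid_real[OF card_chosen1[OF x that]])
    show "real (card {\<omega>\<in>samples m. A v \<omega> \<and> A v' \<omega>}) = p\<^sup>2 * real (card (samples m))"
      if "v \<in> normalized_dirs" "v' \<in> normalized_dirs" "v \<noteq> v'" for v v'
      using card_iid_real[OF card_chosen2[OF x that], of m]
      unfolding A_def p_def samples_def power_mult[symmetric]
      by (simp only: power_mult[symmetric] mult.commute[of m 2] all_conj_distrib imp_conjR)
  qed auto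
  then have "real (card S) * h * h \<le> 4 * real (card (samples m)) * h"
    unfolding K h_def[symmetric] by (simp add: power2_eq_square mult_ac)
  then have "real (card S) * h \<le> 4 * real (card (samples m))" using h by simp
  then have 2: "real (card S) \<le> 4 / h * real (card (samples m))"
    using h by (simp add: field_simps)
  have "{\<omega> \<in> samples m. x \<in> bad_points m \<omega>} \<subseteq> (\<Union>z\<in>I. T z) \<union> S"
  proof
    fix \<omega> assume w: "\<omega> \<in> {\<omega> \<in> samples m. x \<in> bad_points m \<omega>}"
    show "\<omega> \<in> (\<Union>z\<in>I. T z) \<union> S"
    proof (cases "\<exists>i<m. \<exists>j<m. i \<noteq> j \<and> quad (\<omega> i) x = \<zero> \<and> quad (\<omega> j) x = \<zero>")
      case True
      then obtain i j where "(i, j) \<in> I" "\<omega> \<in> T (i, j)" using w by (auto simp: I_def T_def)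
      then show ?thesis by blast
    next
      case False
      then have "real (card {v\<in>normalized_dirs. A v \<omega>}) < h / 2"
        using w unfolding bad_points_def good_dirs_def A_def h_def p_def by auto
      then have "\<omega> \<in> S" using w unfolding S_def K h_def[symmetric] by auto
      then show ?thesis by blast
    qed
  qed
  then have "card {\<omega> \<in> samples m. x \<in> bad_points m \<omega>} \<le> card ((\<Union>z\<in>I. T z) \<union> S)"
    using finI by (intro card_mono) (auto simp: S_def T_def)
  also have "\<dots> \<le> card (\<Union>z\<in>I. T z) + card S" by (rule card_Un_le)
  finally have "real (card {\<omega> \<in> samples m. x \<in> bad_points m \<omega>}) \<le> real (card (\<Union>z\<in>I. T z)) + real (card S)"
    by linarith
  then show ?thesis using 1 2 unfolding h_def p_def by (simp add: distrib_right)
qed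

text \<open>
  Markov's inequality excludes a quarter of the samples and \<open>few_small_zero_sets\<close> at most half.
\<close>

lemma good_sample_exists:
  assumes "3 \<le> d"
  obtains \<omega> where "\<omega> \<in> samples m"
    "real q ^ d * (1 - (1 - 1 / real q) ^ m) - real q ^ (d - 1) \<le> real (card (zeros m \<omega>))"
    "real (card (bad_points m \<omega>))
       \<le> 4 * real q ^ d * ((real m / real q)\<^sup>2 + 4 / (tame_prob ^ m * real q ^ (d - 1)))"
proof -
  define \<epsilon> where "\<epsilon> = (real m / real q)\<^sup>2 + 4 / (tame_prob ^ m * real q ^ (d - 1))"
  define N where "N = real (card (samples m))"
  have N: "0 < N" using card_samples_pos by (simp add: N_def)
  have \<epsilon>: "0 < \<epsilon>" unfolding \<epsilon>_def using tame_prob_pos q_real by (intro add_nonneg_pos) auto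
  define S1 where "S1 = {\<omega> \<in> samples m. real (card (zeros m \<omega>)) < real q ^ d * (1 - (1 - 1 / real q) ^ m) - real q ^ (d - 1)}"
  define S2 where "S2 = {\<omega> \<in> samples m. 4 * real q ^ d * \<epsilon> < real (card (bad_points m \<omega>))}"
  have fin: "finite S1" "finite S2" by (simp_all add: S1_def S2_def)
  have "real (card S2) * (4 * real q ^ d * \<epsilon>) = (\<Sum>\<omega>\<in>S2. 4 * real q ^ d * \<epsilon>)" by simp
  also have "\<dots> \<le> (\<Sum>\<omega>\<in>S2. real (card (bad_points m \<omega>)))"
    by (intro sum_mono) (auto simp: S2_def)
  also have "\<dots> \<le> (\<Sum>\<omega>\<in>samples m. real (card (bad_points m \<omega>)))"
    by (intro sum_mono2) (auto simp: S2_def)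
  also have "\<dots> = (\<Sum>\<omega>\<in>samples m. \<Sum>x\<in>V. of_bool (x \<in> bad_points m \<omega>))"
  proof (rule sum.cong[OF refl])
    fix \<omega>
    have "bad_points m \<omega> \<subseteq> V" unfolding bad_points_def by blast
    then have "V \<inter> bad_points m \<omega> = bad_points m \<omega>" by blast
    then show "real (card (bad_points m \<omega>)) = (\<Sum>x\<in>V. of_bool (x \<in> bad_points m \<omega>))"
      by (simp add: of_bool_def sum.If_cases Int_def)
  qed
  also have "\<dots> = (\<Sum>x\<in>V. \<Sum>\<omega>\<in>samples m. of_bool (x \<in> bad_points m \<omega>))" by (rule sum.swap)
  also have "\<dots> = (\<Sum>x\<in>V. real (card {\<omega>\<in>samples m. x \<in> bad_points m \<omega>}))"
    by (intro sum.cong refl) (simp add: of_bool_def sum.If_cases Int_def)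
  also have "\<dots> \<le> (\<Sum>x\<in>V. \<epsilon> * N)"
    unfolding \<epsilon>_def N_def by (intro sum_mono card_bad_samples)
  also have "\<dots> = real q ^ d * \<epsilon> * N" by (simp add: card_V)
  finally have "(real q ^ d * \<epsilon>) * (4 * real (card S2)) \<le> (real q ^ d * \<epsilon>) * N"
    by (simp add: mult_ac)
  then have S2: "4 * real (card S2) \<le> N"
    using \<epsilon> q_real mult_le_cancel_left_pos[of "real q ^ d * \<epsilon>"] by (simp only: zero_less_power zero_less_mult_iff) blast
  have S1: "2 * real (card S1) \<le> N" using few_small_zero_sets[OF assms, of m] by (simp add: S1_def N_def)
  have "card (S1 \<union> S2) \<le> card S1 + card S2" by (rule card_Un_le)
  then have "real (card (S1 \<union> S2)) \<le> real (card S1) + real (card S2)" by linarith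
  then have "real (card (S1 \<union> S2)) < real (card (samples m))" using S1 S2 N unfolding N_def by linarith
  then have "\<not> samples m \<subseteq> S1 \<union> S2"
    using card_mono[of "S1 \<union> S2" "samples m"] fin by auto
  then obtain \<omega> where "\<omega> \<in> samples m" "\<omega> \<notin> S1" "\<omega> \<notin> S2" by blast
  then show ?thesis using that[of \<omega>] by (auto simp: S1_def S2_def \<epsilon>_def not_less)
qed

section \<open>Punctured lines and repair\<close>

definition punct :: "(nat \<Rightarrow> 'a) \<Rightarrow> (nat \<Rightarrow> 'a) \<Rightarrow> (nat \<Rightarrow> 'a) set" where
  "punct x v = line_pt x v ` (F - {\<zero>})"

lemma punct_subset: "x \<in> V \<Longrightarrow> v \<in> normalized_dirs \<Longrightarrow> punct x v \<subseteq> V"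
  using normalized_dirs_V by (auto simp: punct_def)

lemma card_punct_le: "card (punct x v) \<le> q"
  unfolding punct_def using card_image_le[of "F - {\<zero>}"] card_mono[of F "F - {\<zero>}"]
  by (meson Diff_subset finite_Diff finite_carrier order_trans)

lemma disjoint_punct:
  assumes x: "x \<in> V"
  shows "disjoint_family_on (punct x) normalized_dirs"
  unfolding disjoint_family_on_def
proof (intro ballI impI, rule ccontr)
  fix v v' assume v: "v \<in> normalized_dirs" "v' \<in> normalized_dirs" "v \<noteq> v'" and ne: "punct x v \<inter> punct x v' \<noteq> {}"
  obtain t s where ts: "t \<in> F" "s \<in> F" "t \<noteq> \<zero>" "line_pt x v t = line_pt x v' s"
    using ne by (auto simp: punct_def)
  note vV = normalized_dirs_V[OF v(1)] normalized_dirs_V[OF v(2)]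
  have c: "x i \<oplus> t \<otimes> v i = x i \<oplus> s \<otimes> v' i" if "i < d" for i
    using fun_cong[OF ts(4), of i] that by (simp add: line_pt_def vec_add_def vec_smult_def)
  have c': "t \<otimes> v i = s \<otimes> v' i" if "i < d" for i
    using c[OF that] x vV ts that by simp
  have "t = s" using c'[of 0] two_le_d ts normalized_dirs_0[OF v(1)] normalized_dirs_0[OF v(2)] by simp
  then have "v i = v' i" if "i < d" for i
    using c'[OF that] ts vV that by (simp add: m_lcancel)
  then show False using V_eqI[OF vV] v(3) by blast
qed

lemma punctured_line_eq_punct:
  assumes "x \<in> V" "v \<in> normalized_dirs"
  shows "punctured_line R d x (direction R d v) = punct x v"
  unfolding punctured_line_def direction_def punct_def line_pt_def by auto

lemma direction_in_directions: "v \<in> normalized_dirs \<Longrightarrow> direction R d v \<in> directions R d"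
  unfolding directions_def using normalized_dirs_V normalized_dirs_0 two_le_d
  by (metis (mono_tags, lifting) mem_Collect_eq one_not_zero order_less_le_trans pos2)

text \<open>
  The punctured lines through \<open>x\<close> in the \<open>q ^ (d - 1)\<close> normalized directions are disjoint, so one of them
  has at most the average share of \<open>E\<close>.
\<close>

lemma light_direction:
  assumes "x \<in> V" "E \<subseteq> V"
  shows "\<exists>v\<in>normalized_dirs. real (card (punct x v \<inter> E)) \<le> real (card E) / real q ^ (d - 1)"
proof (rule ccontr)
  assume "\<not> ?thesis"
  then have *: "real (card E) / real q ^ (d - 1) < real (card (punct x v \<inter> E))" if "v \<in> normalized_dirs" for v
    using that not_less by blast
  have K: "real (card normalized_dirs) = real q ^ (d - 1)" by (simp add: card_normalized_dirs)
  have ne: "normalized_dirs \<noteq> {}" using K q_real by auto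
  have finE: "finite E" using assms(2) finite_V finite_subset by blast
  have "real (card E) = (\<Sum>v\<in>normalized_dirs. real (card E) / real q ^ (d - 1))"
    using K q_real by simp
  also have "\<dots> < (\<Sum>v\<in>normalized_dirs. real (card (punct x v \<inter> E)))"
    using ne * by (intro sum_strict_mono) auto
  also have "\<dots> = real (card (\<Union>v\<in>normalized_dirs. punct x v \<inter> E))"
    using disjoint_punct[OF assms(1)] finE unfolding disjoint_family_on_def
    by (subst card_UN_disjoint) auto
  also have "\<dots> \<le> real (card E)" using finE by (intro of_nat_mono card_mono) auto
  finally show False by simp
qed

text \<open>
  Removing \<open>E\<close> from the space and giving back, for each exceptional point in \<open>B\<close>, the points of \<open>E\<close> on a
  light punctured line.
\<close>

lemma nikodym_number_le_repair:
  assumes E: "E \<subseteq> V" and B: "B \<subseteq> V"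
    and good: "\<And>x. x \<in> V - B \<Longrightarrow> \<exists>v\<in>normalized_dirs. punct x v \<inter> E = {}"
  shows "real (nikodym_number R d) \<le> real q ^ d - real (card E) * (1 - real (card B) / real q ^ (d - 1))"
proof -
  have finE: "finite E" and finB: "finite B" using E B finite_V finite_subset by blast+
  define w where "w = (\<lambda>x. SOME v. v \<in> normalized_dirs \<and> real (card (punct x v \<inter> E)) \<le> real (card E) / real q ^ (d - 1))"
  have w: "w x \<in> normalized_dirs" "real (card (punct x (w x) \<inter> E)) \<le> real (card E) / real q ^ (d - 1)"
    if "x \<in> V" for x
  proof -
    have "\<exists>v. v \<in> normalized_dirs \<and> real (card (punct x v \<inter> E)) \<le> real (card E) / real q ^ (d - 1)"
      using light_direction[OF that E] by blast
    from someI_ex[OF this] show "w x \<in> normalized_dirs"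
      "real (card (punct x (w x) \<inter> E)) \<le> real (card E) / real q ^ (d - 1)"
      unfolding w_def by blast+
  qed
  define N where "N = (V - E) \<union> (\<Union>x\<in>B. punct x (w x) \<inter> E)"
  have "N \<subseteq> V" using E by (auto simp: N_def)
  moreover have "\<exists>\<omega>\<in>directions R d. punctured_line R d x \<omega> \<subseteq> N" if x: "x \<in> V" for x
  proof -
    have "\<exists>v\<in>normalized_dirs. punct x v \<subseteq> N"
    proof (cases "x \<in> B")
      case True
      then show ?thesis using w(1)[OF x] punct_subset[OF x w(1)[OF x]] by (auto simp: N_def)
    next
      case False
      then obtain v where v: "v \<in> normalized_dirs" "punct x v \<inter> E = {}" using good x by blast
      have "punct x v \<subseteq> N" using punct_subset[OF x v(1)] v(2) unfolding N_def by blast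
      then show ?thesis using v(1) by blast
    qed
    then obtain v where v: "v \<in> normalized_dirs" "punct x v \<subseteq> N" by blast
    then show ?thesis
      using direction_in_directions[OF v(1)] punctured_line_eq_punct[OF x v(1)] by (intro bexI) simp_all
  qed
  ultimately have "nikodym_set R d N" by (simp add: nikodym_set_def)
  then have "nikodym_number R d \<le> card N" unfolding nikodym_number_def by (intro Least_le) blast
  also have "\<dots> \<le> card (V - E) + card (\<Union>x\<in>B. punct x (w x) \<inter> E)" unfolding N_def by (rule card_Un_le)
  also have "\<dots> \<le> card (V - E) + (\<Sum>x\<in>B. card (punct x (w x) \<inter> E))"
    by (intro add_left_mono card_UN_le[OF finB])
  finally have "real (nikodym_number R d) \<le> real (card (V - E)) + (\<Sum>x\<in>B. real (card (punct x (w x) \<inter> E)))"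
    by (simp flip: of_nat_sum of_nat_add)
  also have "\<dots> \<le> real (card (V - E)) + (\<Sum>x\<in>B. real (card E) / real q ^ (d - 1))"
    using w(2) B by (intro add_left_mono sum_mono) auto
  also have "real (card (V - E)) = real q ^ d - real (card E)"
    using E finE card_mono[OF finite_V E] by (simp add: card_Diff_subset of_nat_diff card_V)
  finally show ?thesis by (simp add: algebra_simps)
qed

text \<open>
  Along a good direction, a quadric that does not contain \<open>x\<close> misses the whole line. At most one quadric
  contains \<open>x\<close>, and it meets the punctured line at most once.
\<close>

lemma card_punct_zeros:
  assumes "\<omega> \<in> samples m" "x \<in> V" "x \<notin> bad_points m \<omega>" "v \<in> good_dirs m \<omega> x"
  shows "card (punct x v \<inter> zeros m \<omega>) \<le> 1"
proof -
  have v: "v \<in> normalized_dirs" "\<And>i. i < m \<Longrightarrow> chosen (\<omega> i) x v"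
    using assms(4) by (auto simp: good_dirs_def)
  have hit: "quad (\<omega> i) x = \<zero>" if "i < m" "t \<in> F" "quad (\<omega> i) (line_pt x v t) = \<zero>" for i t
    using chosen_avoids[OF samples_mem[OF assms(1) that(1)] assms(2) v(1) v(2)[OF that(1)] _ that(2)] that(3) by blast
  have uniq: "i = j" if "i < m" "j < m" "quad (\<omega> i) x = \<zero>" "quad (\<omega> j) x = \<zero>" for i j
    using that assms(2,3) unfolding bad_points_def by blast
  have "y = y'" if yy: "y \<in> punct x v \<inter> zeros m \<omega>" "y' \<in> punct x v \<inter> zeros m \<omega>" for y y'
  proof -
    obtain t i where t: "t \<in> F" "t \<noteq> \<zero>" "y = line_pt x v t" "i < m" "quad (\<omega> i) y = \<zero>"
      using yy(1) by (auto simp: punct_def zeros_def)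
    obtain s j where s: "s \<in> F" "s \<noteq> \<zero>" "y' = line_pt x v s" "j < m" "quad (\<omega> j) y' = \<zero>"
      using yy(2) by (auto simp: punct_def zeros_def)
    have z: "quad (\<omega> i) x = \<zero>" "quad (\<omega> j) x = \<zero>"
      using hit[OF t(4,1)] hit[OF s(4,1)] t s by auto
    then have "i = j" using uniq t(4) s(4) by blast
    then have "t = s"
      using chosen_meets_once[OF samples_mem[OF assms(1) t(4)] assms(2) v(1) v(2)[OF t(4)] z(1) t(1,2) _ s(1,2)] t s
      by auto
    then show ?thesis using t s by simp
  qed
  moreover have "finite (punct x v \<inter> zeros m \<omega>)" by (simp add: zeros_def)
  ultimately show ?thesis by (simp add: card_le_Suc0_iff_eq)
qed

text \<open>
  Here \<open>m\<close> is the number of quadrics, \<open>\<eta>\<close> the probability that a point on them is kept in the Nikodym set,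
  and \<open>s\<close> the probability that a point off them is deleted. A punctured line that meets the quadrics at most
  once is kept with probability at least \<open>\<eta> (1 - s) ^ q\<close>. The deleted set may be larger than \<open>n\<close>; it is cut down to \<open>n\<close> points,
  because the cost of repair is proportional to its size.
\<close>

lemma nikodym_number_upper_bound:
  fixes \<eta> s :: real and m n :: nat
  assumes d: "3 \<le> d" and \<eta>: "0 < \<eta>" and s: "0 \<le> s" "\<eta> + s \<le> 1"
  defines "h \<equiv> tame_prob ^ m * real q ^ (d - 1)"
  defines "\<mu> \<equiv> s * real q ^ d
      + (1 - \<eta> - s) * (real q ^ d * (1 - (1 - 1 / real q) ^ m) - real q ^ (d - 1))
      - (real q ^ d)\<^sup>2 * exp (- (\<eta> * (1 - s) ^ q) * (h / 2))"
  assumes n: "0 < \<mu>" "real n \<le> \<mu>"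
  shows "real (nikodym_number R d) \<le> real q ^ d - real n * (1 - 4 * real q * ((real m / real q)\<^sup>2 + 4 / h))"
proof -
  obtain \<omega> where w: "\<omega> \<in> samples m"
    and Z: "real q ^ d * (1 - (1 - 1 / real q) ^ m) - real q ^ (d - 1) \<le> real (card (zeros m \<omega>))"
    and B: "real (card (bad_points m \<omega>)) \<le> 4 * real q ^ d * ((real m / real q)\<^sup>2 + 4 / h)"
    using good_sample_exists[OF d, of m] unfolding h_def by blast
  define Z where "Z = zeros m \<omega>"
  define B where "B = bad_points m \<omega>"
  have ZV: "Z \<subseteq> V" and BV: "B \<subseteq> V" by (auto simp: Z_def B_def zeros_def bad_points_def)
  have finZ: "finite Z" using ZV finite_V finite_subset by blast
  define \<kappa> where "\<kappa> = (\<lambda>y. if y \<in> Z then \<eta> else 1 - s)"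
  define \<beta> where "\<beta> = \<eta> * (1 - s) ^ q"
  have "(\<Sum>y\<in>V. 1 - \<kappa> y) = (\<Sum>y\<in>Z. 1 - \<eta>) + (\<Sum>y\<in>V - Z. s)"
    using sum.subset_diff[OF ZV finite_V, of "\<lambda>y. 1 - \<kappa> y"] by (simp add: \<kappa>_def)
  also have "\<dots> = real (card Z) * (1 - \<eta>) + (real q ^ d - real (card Z)) * s"
    using ZV finZ card_mono[OF finite_V ZV] by (simp add: card_Diff_subset of_nat_diff card_V)
  also have "\<dots> = s * real q ^ d + (1 - \<eta> - s) * real (card Z)" by (simp add: algebra_simps)
  finally have sum\<kappa>: "s * real q ^ d
      + (1 - \<eta> - s) * (real q ^ d * (1 - (1 - 1 / real q) ^ m) - real q ^ (d - 1)) \<le> (\<Sum>y\<in>V. 1 - \<kappa> y)"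
    using mult_left_mono[OF Z, of "1 - \<eta> - s"] s by (simp add: Z_def)
  have "real (card V) * real (card (V - B)) * exp (- \<beta> * (h / 2)) \<le> (real q ^ d)\<^sup>2 * exp (- \<beta> * (h / 2))"
  proof (intro mult_right_mono)
    have "real (card (V - B)) \<le> real (card V)" using card_mono[OF finite_V, of "V - B"] by auto
    then show "real (card V) * real (card (V - B)) \<le> (real q ^ d)\<^sup>2"
      by (simp add: card_V power2_eq_square mult_left_mono)
  qed simp
  then have \<mu>: "\<mu> \<le> (\<Sum>y\<in>V. 1 - \<kappa> y) - real (card V) * real (card (V - B)) * exp (- \<beta> * (h / 2))"
    using sum\<kappa> unfolding \<mu>_def \<beta>_def by linarith
  have prod: "\<beta> \<le> (\<Prod>y\<in>punct x v. \<kappa> y)" if x: "x \<in> V - B" and v: "v \<in> good_dirs m \<omega> x" for x v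
  proof -
    have vd: "v \<in> normalized_dirs" using v by (simp add: good_dirs_def)
    have fin: "finite (punct x v)" by (simp add: punct_def)
    have "(\<Prod>y\<in>punct x v. \<kappa> y) = (\<Prod>y\<in>punct x v \<inter> Z. \<kappa> y) * (\<Prod>y\<in>punct x v - Z. \<kappa> y)"
      using prod.Int_Diff[OF fin] .
    also have "\<dots> = \<eta> ^ card (punct x v \<inter> Z) * (1 - s) ^ card (punct x v - Z)" by (simp add: \<kappa>_def)
    also have "\<dots> \<ge> \<eta> ^ 1 * (1 - s) ^ q"
    proof (intro mult_mono power_decreasing)
      show "card (punct x v \<inter> Z) \<le> 1"
        using card_punct_zeros[OF w _ _ v] x by (simp add: Z_def B_def)
      show "card (punct x v - Z) \<le> q"
        using card_mono[OF fin, of "punct x v - Z"] card_punct_le[of x v] by simp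
    qed (use \<eta> s in auto)
    finally show ?thesis by (simp add: \<beta>_def)
  qed
  obtain E where E: "E \<subseteq> V" "\<mu> \<le> real (card E)" "\<And>x. x \<in> V - B \<Longrightarrow> \<exists>v\<in>good_dirs m \<omega> x. punct x v \<inter> E = {}"
  proof (rule exists_sparse_deletion[of V "V - B" \<kappa> "good_dirs m \<omega>" "h / 2" punct \<beta> \<mu>])
    show "0 \<le> \<kappa> y \<and> \<kappa> y \<le> 1" for y using \<eta> s by (auto simp: \<kappa>_def)
    show "finite (good_dirs m \<omega> x)" for x by (simp add: good_dirs_def)
    show "h / 2 \<le> real (card (good_dirs m \<omega> x))" if "x \<in> V - B" for x
      using that unfolding B_def bad_points_def h_def by auto
    show "punct x j \<subseteq> V" if "x \<in> V - B" "j \<in> good_dirs m \<omega> x" for x j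
      using that punct_subset by (auto simp: good_dirs_def)
    show "disjoint_family_on (punct x) (good_dirs m \<omega> x)" if "x \<in> V - B" for x
      using disjoint_family_on_mono[OF _ disjoint_punct] that by (auto simp: good_dirs_def)
    show "0 \<le> \<beta>" using \<eta> s by (simp add: \<beta>_def)
  qed (use prod \<mu> n in auto)
  have "n \<le> card E" using n E(2) by linarith
  then obtain E' where E': "E' \<subseteq> E" "card E' = n" using obtain_subset_with_card_n by metis
  have "real (nikodym_number R d) \<le> real q ^ d - real (card E') * (1 - real (card B) / real q ^ (d - 1))"
  proof (rule nikodym_number_le_repair)
    show "E' \<subseteq> V" using E E' by blast
    show "\<exists>v\<in>normalized_dirs. punct x v \<inter> E' = {}" if x: "x \<in> V - B" for x
    proof -
      obtain v where "v \<in> good_dirs m \<omega> x" "punct x v \<inter> E = {}" using E(3)[OF x] by blast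
      then show ?thesis using E'(1) unfolding good_dirs_def by blast
    qed
  qed (rule BV)
  also have "\<dots> \<le> real q ^ d - real n * (1 - 4 * real q * ((real m / real q)\<^sup>2 + 4 / h))"
  proof -
    have "real (card B) \<le> 4 * real q * ((real m / real q)\<^sup>2 + 4 / h) * real q ^ (d - 1)"
    proof -
      have "real q ^ d = real q * real q ^ (d - 1)" using d power_Suc[of "real q" "d - 1"] by simp
      then show ?thesis using B unfolding B_def by (simp only: mult_ac)
    qed
    then have "real (card B) / real q ^ (d - 1) \<le> 4 * real q * ((real m / real q)\<^sup>2 + 4 / h)"
      using q_real by (simp add: pos_divide_le_eq)
    then show ?thesis unfolding E'(2) by (intro diff_left_mono mult_left_mono) auto
  qed
  finally show ?thesis .
qed

end

section \<open>Asymptotics\<close>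

text \<open>
  Both sides are compared with \<open>exp (- m u)\<close>.
\<close>

lemma one_minus_power_le: 
  fixes u :: real assumes "0 \<le> u" "u \<le> 1"
  shows "(1 - u) ^ m \<le> 1 / (1 + real m * u)"
proof -
  have "(1 - u) ^ m \<le> exp (- u) ^ m"
    using assms exp_ge_add_one_self[of "- u"] by (intro power_mono) auto
  also have "\<dots> = 1 / exp (real m * u)" unfolding exp_of_nat_mult[symmetric] by (simp add: exp_minus inverse_eq_divide)
  also have "\<dots> \<le> 1 / (1 + real m * u)"
    using assms exp_ge_add_one_self[of "real m * u"] by (intro divide_left_mono mult_pos_pos) (auto intro: add_pos_nonneg)
  finally show ?thesis .
qed

text \<open>
  An upper bound for the repair cost of the deleted set, as a proportion of its size, when there are at most
  \<open>k ln x\<close> quadrics and they leave at least \<open>x powr (1 + \<epsilon>) / 2\<close> directions on average.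
\<close>

definition loss :: "real \<Rightarrow> real \<Rightarrow> real \<Rightarrow> real" where
  "loss k \<epsilon> x = 4 * x * ((k * ln x / x)\<^sup>2 + 8 * x powr (- 1 - \<epsilon>))"

text \<open>
  A lower bound, up to a bounded term, for the size of the deleted set in units of \<open>x ^ (d - 1)\<close>: the random points contribute
  \<open>ln x\<close>, and \<open>k ln x\<close> quadrics, thinned by \<open>\<eta>\<close>, contribute asymptotically \<open>(1 - \<eta>) k ln x\<close>.
\<close>

definition gain :: "real \<Rightarrow> real \<Rightarrow> real \<Rightarrow> real" where
  "gain k \<eta> x = ln x + (1 - \<eta> - ln x / x) * ((k * ln x - 1) / (1 + k * ln x / x) - 1)"

text \<open>
  All the requirements on the size of the field, collected for a real variable in place of \<open>q\<close>. The last one holds because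
  \<open>gain k \<eta> x / ln x\<close> tends to \<open>1 + (1 - \<eta>) k\<close> and \<open>loss k \<epsilon> x\<close> tends to \<open>0\<close>.
\<close>

lemma eventually_parameters:
  fixes k \<eta> \<epsilon> T :: real
  assumes "0 < k" "0 < \<eta>" "\<eta> < 1" "0 < \<epsilon>" "\<epsilon> < 1" and T: "T < 1 + (1 - \<eta>) * k"
  shows "eventually (\<lambda>x. 2 \<le> x \<and> 1 \<le> k * ln x \<and> k * ln x / x \<le> 1 / 2 \<and> \<eta> + ln x / x \<le> 1
    \<and> 3 \<le> gain k \<eta> x \<and> loss k \<epsilon> x \<le> 1
    \<and> x powr (2 * real d) * exp (- (\<eta> * (1 - ln x / x) powr x) * (x powr (1 + \<epsilon>) / 4)) \<le> 1
    \<and> T * ln x \<le> (gain k \<eta> x - 2) * (1 - loss k \<epsilon> x)) at_top"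
proof -
  define c where "c = 1 - \<eta>"
  have c: "0 < c" and pos: "0 < 1 + c * k" using assms by (auto simp: c_def intro: add_pos_pos)
  have loss: "(loss k \<epsilon> \<longlongrightarrow> 0) at_top"
    unfolding loss_def using assms(1,4,5) by real_asymp
  have gain: "((\<lambda>x. (gain k \<eta> x - 2) / ln x) \<longlongrightarrow> 1 + c * k) at_top"
    unfolding gain_def c_def[symmetric] using assms(1) c by real_asymp
  have gain': "filterlim (gain k \<eta>) at_top at_top"
    unfolding gain_def c_def[symmetric] using assms(1) c pos by real_asymp
  have err: "((\<lambda>x. x powr (2 * real d) * exp (- (\<eta> * (1 - ln x / x) powr x) * (x powr (1 + \<epsilon>) / 4))) \<longlongrightarrow> 0) at_top"
    using assms(2,4) by real_asymp
  have "((\<lambda>x. (gain k \<eta> x - 2) / ln x * (1 - loss k \<epsilon> x)) \<longlongrightarrow> (1 + c * k) * (1 - 0)) at_top"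
    by (intro tendsto_intros gain loss)
  then have e1: "eventually (\<lambda>x. T < (gain k \<eta> x - 2) / ln x * (1 - loss k \<epsilon> x)) at_top"
    using T by (intro order_tendstoD(1)) (auto simp: c_def)
  have e2: "eventually (\<lambda>x. 1 \<le> k * ln x) at_top" using assms(1) by real_asymp
  have e3: "eventually (\<lambda>x. k * ln x / x < 1 / 2) at_top" using assms(1) by real_asymp
  have e4: "eventually (\<lambda>x::real. ln x / x < c) at_top" using c by real_asymp
  have e5: "eventually (\<lambda>x. 3 \<le> gain k \<eta> x) at_top" using gain' by (simp add: filterlim_at_top)
  have e6: "eventually (\<lambda>x. loss k \<epsilon> x < 1) at_top" using loss by (rule order_tendstoD) simp
  have e7: "eventually (\<lambda>x. x powr (2 * real d) * exp (- (\<eta> * (1 - ln x / x) powr x) * (x powr (1 + \<epsilon>) / 4)) < 1) at_top"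
    using err by (rule order_tendstoD) simp
  show ?thesis
    using e1 e2 e3 e4 e5 e6 e7 eventually_ge_at_top[of 2]
  proof eventually_elim
    case (elim x)
    have "0 < ln x" using elim(8) by simp
    then have "T * ln x < (gain k \<eta> x - 2) * (1 - loss k \<epsilon> x)"
      using elim(1) by (simp add: pos_less_divide_eq)
    then show ?case using elim by (auto simp: c_def)
  qed
qed

text \<open>
  The number of quadrics is \<open>k ln q\<close> rounded down. As \<open>2 powr (k ln q) = q powr (d - 2 - \<epsilon>)\<close>, they leave about
  \<open>q powr (1 + \<epsilon>)\<close> directions, and with \<open>s = ln q / q\<close> the random deletion leaves about \<open>q powr \<epsilon>\<close> of these,
  which is why the failure term is exponentially small.
\<close>

lemma (in finite_affine_space) nikodym_number_upper_bound_explicit: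
  fixes \<epsilon> \<eta> T :: real
  defines "k \<equiv> (real d - 2 - \<epsilon>) / ln 2" and "x \<equiv> real q"
  assumes d: "3 \<le> d" and \<epsilon>: "0 < \<epsilon>" "\<epsilon> < 1" and \<eta>: "0 < \<eta>"
    and P: "1 \<le> k * ln x" "k * ln x / x \<le> 1 / 2" "\<eta> + ln x / x \<le> 1"
      "3 \<le> gain k \<eta> x" "loss k \<epsilon> x \<le> 1"
      "x powr (2 * real d) * exp (- (\<eta> * (1 - ln x / x) powr x) * (x powr (1 + \<epsilon>) / 4)) \<le> 1"
      "T * ln x \<le> (gain k \<eta> x - 2) * (1 - loss k \<epsilon> x)"
  shows "real (nikodym_number R d) \<le> x ^ d - T * x ^ (d - 1) * ln x"
proof -
  have x: "2 \<le> x" "0 < x" using q_real by (auto simp: x_def)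
  define M where "M = k * ln x"
  define m where "m = nat \<lfloor>M\<rfloor>"
  define s where "s = ln x / x"
  define h where "h = tame_prob ^ m * x ^ (d - 1)"
  have M: "1 \<le> M" using P(1) by (simp add: M_def)
  have m: "real m \<le> M" "M - 1 \<le> real m" using M by (auto simp: m_def)
  have s: "0 \<le> s" "\<eta> + s \<le> 1" using P(3) x by (auto simp: s_def)
  have xd: "x ^ d = x * x ^ (d - 1)" using d power_Suc[of x "d - 1"] by simp
  have xd1: "1 \<le> x ^ (d - 1)" using x by (intro one_le_power) auto
  \<comment> \<open>Half the expected number of good directions is at least \<open>x powr (1 + \<epsilon>) / 4\<close>: Bernoulli's inequality
    shows that \<open>tame_prob ^ m\<close> is at least half of \<open>2 powr (- M)\<close>.\<close>
  have hge: "x powr (1 + \<epsilon>) / 2 \<le> h"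
  proof -
    have "2 powr real m \<le> 2 powr M" using m by simp
    also have "\<dots> = x powr (real d - 2 - \<epsilon>)"
      using x by (simp add: M_def k_def powr_def)
    finally have 2: "2 ^ m \<le> x powr (real d - 2 - \<epsilon>)" by (simp add: powr_realpow)
    have "1 / 2 \<le> 1 - real m / x"
      using m P(2) divide_right_mono[OF m(1), of x] x by (simp add: M_def)
    also have "\<dots> \<le> (1 - 1 / x) ^ m"
      using Bernoulli_inequality[of "- 1 / x" m] x by simp
    finally have b: "1 / 2 \<le> (1 - 1 / x) ^ m" .
    have "tame_prob = (1 - 1 / x) / 2" using x by (simp add: tame_prob_def x_def[symmetric] field_simps)
    then have "tame_prob ^ m = (1 - 1 / x) ^ m / 2 ^ m" by (simp only: power_divide)
    moreover have "x ^ (d - 1) = x powr (real d - 1)"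
      using powr_realpow[of x "d - 1"] x d by (simp add: of_nat_diff)
    ultimately have "h = (1 - 1 / x) ^ m / 2 ^ m * x powr (real d - 1)" by (simp only: h_def)
    also have "\<dots> \<ge> (1 / 2) / x powr (real d - 2 - \<epsilon>) * x powr (real d - 1)"
      using b 2 x by (intro mult_right_mono frac_le) auto
    also have "(1 / 2) / x powr (real d - 2 - \<epsilon>) * x powr (real d - 1) = x powr (1 + \<epsilon>) / 2"
    proof -
      have "x powr (real d - 1) = x powr (1 + \<epsilon>) * x powr (real d - 2 - \<epsilon>)"
        unfolding powr_add[symmetric] by (rule arg_cong[where f = "(powr) x"]) simp
      then show ?thesis using x by simp
    qed
    finally show ?thesis .
  qed
  have "0 < x powr (1 + \<epsilon>) / 2" using x by simp
  then have h: "0 < h" using hge by (rule less_le_trans)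
  have h4: "4 / h \<le> 8 * x powr (- 1 - \<epsilon>)"
  proof -
    have "4 / h \<le> 4 / (x powr (1 + \<epsilon>) / 2)" using hge h x by (intro divide_left_mono mult_pos_pos) auto
    also have "\<dots> = 8 * (1 / x powr (1 + \<epsilon>))" by (simp only: divide_divide_eq_right)
    also have "1 / x powr (1 + \<epsilon>) = x powr (- 1 - \<epsilon>)"
      unfolding powr_minus_divide[symmetric] by (rule arg_cong[where f = "(powr) x"]) simp
    finally show ?thesis .
  qed
  have loss: "4 * x * ((real m / x)\<^sup>2 + 4 / h) \<le> loss k \<epsilon> x"
    unfolding loss_def M_def[symmetric] using h4 m x
    by (intro mult_left_mono add_mono power_mono divide_right_mono) auto
  define Z where "Z = x ^ d * (1 - (1 - 1 / x) ^ m) - x ^ (d - 1)"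
  have Z: "x ^ (d - 1) * ((M - 1) / (1 + M / x) - 1) \<le> Z"
  proof -
    have "(M - 1) / (1 + M / x) \<le> real m / (1 + real m / x)"
      using m M x by (intro frac_le add_left_mono divide_right_mono) (auto intro: add_pos_nonneg)
    also have "\<dots> = x * (1 - 1 / (1 + real m * (1 / x)))"
      using x by (simp add: field_simps add_pos_nonneg)
    also have "\<dots> \<le> x * (1 - (1 - 1 / x) ^ m)"
      using one_minus_power_le[of "1 / x" m] x by (intro mult_left_mono) auto
    finally have "x ^ (d - 1) * ((M - 1) / (1 + M / x) - 1) \<le> x ^ (d - 1) * (x * (1 - (1 - 1 / x) ^ m) - 1)"
      using x by (intro mult_left_mono) auto
    then show ?thesis unfolding Z_def xd by (simp add: algebra_simps)
  qed
  have err: "(x ^ d)\<^sup>2 * exp (- (\<eta> * (1 - s) ^ q) * (h / 2)) \<le> 1"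
  proof -
    have "s < 1" using s(2) \<eta> by linarith
    then have "(1 - s) ^ q = (1 - s) powr x" by (simp add: x_def powr_realpow)
    moreover have "(x ^ d)\<^sup>2 = x powr (2 * real d)"
      using x by (simp add: powr_realpow[symmetric] powr_powr flip: power_mult)
        (simp add: powr_realpow[symmetric] mult.commute)
    moreover have "\<eta> * (1 - s) powr x * (x powr (1 + \<epsilon>) / 4) \<le> \<eta> * (1 - s) powr x * (h / 2)"
      using hge \<eta> by (intro mult_left_mono) auto
    then have "x powr (2 * real d) * exp (- (\<eta> * (1 - s) powr x) * (h / 2))
        \<le> x powr (2 * real d) * exp (- (\<eta> * (1 - s) powr x) * (x powr (1 + \<epsilon>) / 4))"
      by (intro mult_left_mono) auto
    ultimately show ?thesis using P(6) unfolding s_def by simp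
  qed
  define \<mu> where "\<mu> = s * x ^ d + (1 - \<eta> - s) * Z - (x ^ d)\<^sup>2 * exp (- (\<eta> * (1 - s) ^ q) * (h / 2))"
  have "s * x ^ d = x ^ (d - 1) * ln x" unfolding xd s_def using x by simp
  moreover have "(1 - \<eta> - s) * (x ^ (d - 1) * ((M - 1) / (1 + M / x) - 1)) \<le> (1 - \<eta> - s) * Z"
    using Z s by (intro mult_left_mono) auto
  ultimately have \<mu>: "x ^ (d - 1) * gain k \<eta> x - 1 \<le> \<mu>"
    using err unfolding \<mu>_def gain_def M_def[symmetric] s_def[symmetric] by (simp add: algebra_simps)
  have "x ^ (d - 1) * 3 \<le> x ^ (d - 1) * gain k \<eta> x" using P(4) x by (intro mult_left_mono) auto
  then have \<mu>2: "2 \<le> \<mu>" using \<mu> xd1 by linarith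
  define n where "n = nat \<lfloor>\<mu>\<rfloor>"
  have n: "real n \<le> \<mu>" "\<mu> - 1 \<le> real n" using \<mu>2 by (auto simp: n_def)
  have "real (nikodym_number R d) \<le> x ^ d - real n * (1 - 4 * x * ((real m / x)\<^sup>2 + 4 / h))"
    unfolding x_def h_def
    using d \<eta> s(1,2) \<mu>2 n(1) unfolding \<mu>_def Z_def h_def x_def
    by (intro nikodym_number_upper_bound[where \<eta> = \<eta> and s = s]) auto
  also have "\<dots> \<le> x ^ d - real n * (1 - loss k \<epsilon> x)"
    using loss by (intro diff_left_mono mult_left_mono) auto
  also have "\<dots> \<le> x ^ d - (x ^ (d - 1) * (gain k \<eta> x - 2)) * (1 - loss k \<epsilon> x)"
  proof (intro diff_left_mono mult_right_mono)
    show "x ^ (d - 1) * (gain k \<eta> x - 2) \<le> real n" using \<mu> n(2) xd1 by (simp add: right_diff_distrib)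
  qed (use P(5) in auto)
  also have "\<dots> \<le> x ^ d - x ^ (d - 1) * (T * ln x)"
    using mult_left_mono[OF P(7), of "x ^ (d - 1)"] x by (simp add: mult.assoc)
  finally show ?thesis by (simp add: mult_ac)
qed

theorem theorem1p1:
  fixes d :: nat
  assumes "d \<ge> 3"
  shows "\<forall>\<delta>::real. \<delta> > 0 \<longrightarrow>
    (\<exists>q0::nat. \<forall>q::nat. q \<ge> q0 \<and> odd q \<and> primepow q \<longrightarrow>
      (\<forall>R. is_GF q R \<longrightarrow>
        real (nikodym_number R d)
          \<le> real q ^ d - ((real d - 2) / ln 2 + 1 - \<delta>) * real q ^ (d - 1) * ln (real q)))"
proof (intro allI impI)
  fix \<delta> :: real assume \<delta>: "\<delta> > 0"
  define D where "D = real d - 2"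
  have D: "1 \<le> D" using assms by (simp add: D_def)
  have l2: "0 < ln (2::real)" by simp
  \<comment> \<open>The losses \<open>\<epsilon> / ln 2\<close> and \<open>\<eta> D / ln 2\<close> in the leading coefficient are at most \<open>\<delta> / 4\<close> each.\<close>
  define \<epsilon> where "\<epsilon> = min (1 / 2) (\<delta> * ln 2 / 4)"
  define \<eta> where "\<eta> = min (1 / 2) (\<delta> * ln 2 / (4 * D))"
  define k where "k = (D - \<epsilon>) / ln 2"
  define T where "T = D / ln 2 + 1 - \<delta>"
  have "0 < \<delta> * ln 2" using \<delta> by simp
  then have \<epsilon>: "0 < \<epsilon>" "\<epsilon> < 1" "\<epsilon> \<le> \<delta> * ln 2 / 4" and \<eta>: "0 < \<eta>" "\<eta> < 1" "\<eta> \<le> \<delta> * ln 2 / (4 * D)"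
    using D by (auto simp: \<epsilon>_def \<eta>_def min_less_iff_disj)
  have k: "0 < k" using D \<epsilon> l2 by (simp add: k_def)
  have "\<eta> * D \<le> \<delta> * ln 2 / 4"
    using mult_right_mono[OF \<eta>(3), of D] D by simp
  moreover have "\<eta> * (D - \<epsilon>) \<le> \<eta> * D" using \<eta> \<epsilon> by (intro mult_left_mono) auto
  ultimately have "D - \<delta> * ln 2 < (1 - \<eta>) * (D - \<epsilon>)"
    using \<epsilon>(3) \<open>0 < \<delta> * ln 2\<close> by (simp add: left_diff_distrib)
  from this l2 have "(D - \<delta> * ln 2) / ln 2 < (1 - \<eta>) * (D - \<epsilon>) / ln 2" by (rule divide_strict_right_mono)
  also have "\<dots> = (1 - \<eta>) * k" by (simp only: k_def times_divide_eq_right)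
  finally have T: "T < 1 + (1 - \<eta>) * k" by (simp add: T_def diff_divide_distrib)
  obtain X where X: "\<And>x. X \<le> x \<Longrightarrow> 2 \<le> x \<and> 1 \<le> k * ln x \<and> k * ln x / x \<le> 1 / 2 \<and> \<eta> + ln x / x \<le> 1
    \<and> 3 \<le> gain k \<eta> x \<and> loss k \<epsilon> x \<le> 1
    \<and> x powr (2 * real d) * exp (- (\<eta> * (1 - ln x / x) powr x) * (x powr (1 + \<epsilon>) / 4)) \<le> 1
    \<and> T * ln x \<le> (gain k \<eta> x - 2) * (1 - loss k \<epsilon> x)"
    using eventually_parameters[OF k \<eta>(1,2) \<epsilon>(1,2) T, of d] unfolding eventually_at_top_linorder by blast
  show "\<exists>q0::nat. \<forall>q::nat. q \<ge> q0 \<and> odd q \<and> primepow q \<longrightarrow>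
      (\<forall>R. is_GF q R \<longrightarrow>
        real (nikodym_number R d)
          \<le> real q ^ d - ((real d - 2) / ln 2 + 1 - \<delta>) * real q ^ (d - 1) * ln (real q))"
  proof (intro exI allI impI)
    fix q :: nat and R :: "nat ring"
    assume q: "q \<ge> nat \<lceil>X\<rceil> \<and> odd q \<and> primepow q" and R: "is_GF q R"
    then interpret finite_affine_space R d
      using assms unfolding is_GF_def finite_affine_space_def finite_affine_space_axioms_def by auto
    have qR: "card (carrier R) = q" using R by (simp add: is_GF_def order_def)
    have "X \<le> real q" using q by linarith
    from X[OF this] show "real (nikodym_number R d)
          \<le> real q ^ d - ((real d - 2) / ln 2 + 1 - \<delta>) * real q ^ (d - 1) * ln (real q)"
      using nikodym_number_upper_bound_explicit[OF assms \<epsilon>(1,2) \<eta>(1), of T, unfolded qR]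
      unfolding k_def D_def T_def by blast
  qed
qed

end
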